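(* For every integer $l\ge 2$, $$P_{x_{1,l,1},w_{1,l,1}}=1+q^{l-1}.$$
   Context: $P_{x,w}=P_{x,w}(q)$ denotes the Kazhdan–Lusztig polynomial indexed by $x,w$ in the symmetric group $\mathfrak{S}_n$ (normalized as usual: $P_{x,w}=0$ unless $x\le w$ in Bruhat order, $P_{w,w}=1$, and $\deg P_{x,w}\le\frac12(\ell(w)-\ell(x)-1)$ for $x<w$, with $\ell$ the length function). In $\mathfrak{S}_{l+2}$, in one-line notation, $$x_{1,l,1}=[1,\;l+1,\ldots,2,\;l+2],\qquad w_{1,l,1}=[l+1,\;l+2,\;l,\ldots,3,\;1,\;2],$$ where each range "$a,\ldots,b$" denotes the decreasing run of consecutive integers from $a$ down to $b$, which is empty if $a<b$. *)

theory Defs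
  imports
    "HOL-Combinatorics.Permutations"
    "HOL-Combinatorics.Transposition"
    "HOL-Library.Poly_Mapping"
    "HOL-Computational_Algebra.Polynomial"
begin

section \<open>The symmetric group as a Coxeter group\<close>

text \<open>
  Elements of the symmetric group on \<open>{1..n}\<close> are the functions \<open>w\<close> with \<open>w permutes {1..n}\<close>;
  the product is composition.
\<close>

text \<open>The \<open>i\<close>-th entry of the list, counting from 1, is the image of \<open>i\<close>.\<close>

definition one_line :: "nat list \<Rightarrow> nat \<Rightarrow> nat" where
  "one_line xs = permutation_of_list (zip [1..<Suc (length xs)] xs)"

definition decreasing_run :: "nat \<Rightarrow> nat \<Rightarrow> nat list" where
  "decreasing_run a b = rev [b..<Suc a]"

definition simple_refl :: "nat \<Rightarrow> nat \<Rightarrow> nat" where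
  "simple_refl i = transpose i (Suc i)"

definition word_prod :: "nat list \<Rightarrow> nat \<Rightarrow> nat" where
  "word_prod is = foldr (\<lambda>i u. simple_refl i \<circ> u) is id"

definition coxeter_length :: "nat \<Rightarrow> (nat \<Rightarrow> nat) \<Rightarrow> nat" where
  "coxeter_length n w =
     (LEAST k. \<exists>is. set is \<subseteq> {1..<n} \<and> word_prod is = w \<and> length is = k)"

definition reduced_word :: "nat \<Rightarrow> (nat \<Rightarrow> nat) \<Rightarrow> nat list \<Rightarrow> bool" where
  "reduced_word n w is \<longleftrightarrow>
     set is \<subseteq> {1..<n} \<and> word_prod is = w \<and> length is = coxeter_length n w"

text \<open>
  Bruhat order: the reflexive transitive closure of multiplication by a transposition that
  increases the length.
\<close>

definition bruhat_step :: "nat \<Rightarrow> (nat \<Rightarrow> nat) \<Rightarrow> (nat \<Rightarrow> nat) \<Rightarrow> bool" where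
  "bruhat_step n u w \<longleftrightarrow>
     (\<exists>a\<in>{1..n}. \<exists>b\<in>{1..n}. a \<noteq> b \<and> w = u \<circ> transpose a b)
       \<and> coxeter_length n u < coxeter_length n w"

definition bruhat_le :: "nat \<Rightarrow> (nat \<Rightarrow> nat) \<Rightarrow> (nat \<Rightarrow> nat) \<Rightarrow> bool" where
  "bruhat_le n u w \<longleftrightarrow> u permutes {1..n} \<and> w permutes {1..n} \<and> (bruhat_step n)\<^sup>*\<^sup>* u w"


section \<open>Laurent polynomials in the square root of q\<close>

text \<open>
  Integer Laurent polynomials in \<open>v\<close>, where \<open>v\<^sup>2 = q\<close>: the finitely supported functions
  from exponents to coefficients, with convolution as product.
\<close>

type_synonym laurent = "int \<Rightarrow>\<^sub>0 int"

definition v_pow :: "int \<Rightarrow> laurent" where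
  "v_pow k = Poly_Mapping.single k 1"

abbreviation q_laurent :: laurent where
  "q_laurent \<equiv> v_pow 2"

definition laurent_bar :: "laurent \<Rightarrow> laurent" where
  "laurent_bar f = Poly_Mapping.map_key uminus f"

definition eval_at_q :: "int poly \<Rightarrow> laurent" where
  "eval_at_q p = poly (map_poly of_int p) q_laurent"


section \<open>The Hecke algebra\<close>

text \<open>
  An element of the Hecke algebra is given by its coefficients with respect to the standard basis
  \<open>T\<close>. Only the coefficients at permutations of \<open>{1..n}\<close> are meaningful; the others are required
  to be zero.
\<close>

type_synonym hecke = "(nat \<Rightarrow> nat) \<Rightarrow> laurent"

definition hecke_carrier :: "nat \<Rightarrow> hecke set" where
  "hecke_carrier n = {h. \<forall>w. \<not> w permutes {1..n} \<longrightarrow> h w = 0}"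

definition hecke_T :: "(nat \<Rightarrow> nat) \<Rightarrow> hecke" where
  "hecke_T w = (\<lambda>u. if u = w then 1 else 0)"

text \<open>The product of \<open>T\<^sub>s\<close> and \<open>T\<^sub>w\<close>, where \<open>s = simple_refl i\<close>.\<close>

definition hecke_gen_T :: "nat \<Rightarrow> nat \<Rightarrow> (nat \<Rightarrow> nat) \<Rightarrow> hecke" where
  "hecke_gen_T n i w =
     (if coxeter_length n w < coxeter_length n (simple_refl i \<circ> w)
      then hecke_T (simple_refl i \<circ> w)
      else (\<lambda>u. (q_laurent - 1) * hecke_T w u + q_laurent * hecke_T (simple_refl i \<circ> w) u))"

definition hecke_gen_mult :: "nat \<Rightarrow> nat \<Rightarrow> hecke \<Rightarrow> hecke" where
  "hecke_gen_mult n i h = (\<lambda>u. \<Sum>w | w permutes {1..n}. h w * hecke_gen_T n i w u)"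

text \<open>
  \<open>T\<^sub>x\<close> is the product of the generators along a reduced word of \<open>x\<close>; by the braid relations the
  chosen reduced word does not matter.
\<close>

definition hecke_T_mult :: "nat \<Rightarrow> (nat \<Rightarrow> nat) \<Rightarrow> hecke \<Rightarrow> hecke" where
  "hecke_T_mult n x h = foldr (hecke_gen_mult n) (SOME is. reduced_word n x is) h"

definition hecke_mult :: "nat \<Rightarrow> hecke \<Rightarrow> hecke \<Rightarrow> hecke" where
  "hecke_mult n g h = (\<lambda>u. \<Sum>x | x permutes {1..n}. g x * hecke_T_mult n x h u)"

definition hecke_inverse :: "nat \<Rightarrow> hecke \<Rightarrow> hecke" where
  "hecke_inverse n g =
     (THE h. h \<in> hecke_carrier n \<and> hecke_mult n g h = hecke_T id \<and> hecke_mult n h g = hecke_T id)"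

text \<open>
  The bar involution: additive, sending \<open>v\<close> to \<open>v\<^sup>-\<^sup>1\<close> in the coefficients and each \<open>hecke_T w\<close>
  to the inverse of \<open>hecke_T (inv w)\<close>.
\<close>

definition hecke_bar :: "nat \<Rightarrow> hecke \<Rightarrow> hecke" where
  "hecke_bar n h =
     (\<lambda>u. \<Sum>w | w permutes {1..n}. laurent_bar (h w) * hecke_inverse n (hecke_T (inv w)) u)"


section \<open>Kazhdan--Lusztig polynomials\<close>

text \<open>
  For a family \<open>p\<close> of polynomials, the element \<open>q\<^bsup>-l(w)/2\<^esup> \<Sum>\<^sub>x p\<^sub>x(q) T\<^sub>x\<close>. For the
  Kazhdan--Lusztig polynomials this is the basis element commonly written \<open>C'\<^sub>w\<close>.
\<close>

definition hecke_of_polys :: "nat \<Rightarrow> (nat \<Rightarrow> nat) \<Rightarrow> ((nat \<Rightarrow> nat) \<Rightarrow> int poly) \<Rightarrow> hecke" where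
  "hecke_of_polys n w p = (\<lambda>x. v_pow (- int (coxeter_length n w)) * eval_at_q (p x))"

definition is_KL_family :: "nat \<Rightarrow> (nat \<Rightarrow> nat) \<Rightarrow> ((nat \<Rightarrow> nat) \<Rightarrow> int poly) \<Rightarrow> bool" where
  "is_KL_family n w p \<longleftrightarrow>
     p w = 1 \<and>
     (\<forall>x. \<not> bruhat_le n x w \<longrightarrow> p x = 0) \<and>
     (\<forall>x. bruhat_le n x w \<and> x \<noteq> w \<longrightarrow>
        real (degree (p x)) \<le> (real (coxeter_length n w) - real (coxeter_length n x) - 1) / 2) \<and>
     hecke_bar n (hecke_of_polys n w p) = hecke_of_polys n w p"

text \<open>
  Kazhdan and Lusztig's theorem: for every \<open>w\<close> in the symmetric group exactly one family
  satisfies \<^const>\<open>is_KL_family\<close>.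
\<close>

definition KL_poly :: "nat \<Rightarrow> (nat \<Rightarrow> nat) \<Rightarrow> (nat \<Rightarrow> nat) \<Rightarrow> int poly" where
  "KL_poly n x w = (THE p. is_KL_family n w p) x"


section \<open>The two permutations\<close>

definition x_perm :: "nat \<Rightarrow> nat \<Rightarrow> nat" where
  "x_perm l = one_line ([1] @ decreasing_run (l + 1) 2 @ [l + 2])"

definition w_perm :: "nat \<Rightarrow> nat \<Rightarrow> nat" where
  "w_perm l = one_line ([l + 1, l + 2] @ decreasing_run l 3 @ [1, 2])"

end

theory Submission
  imports Defs
begin

text \<open>
  Put \<open>n = l + 2\<close>. The permutation \<open>w_perm l\<close> is the longest one with \<open>x 1 \<noteq> n\<close> and \<open>x n \<noteq> 1\<close>, and the
  permutations below it are exactly those with these two properties. Its Schubert variety consists of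
  the flags \<open>F\<close> with \<open>F\<^sub>1 \<subseteq> E\<^sub>n\<^sub>-\<^sub>1\<close> and \<open>E\<^sub>1 \<subseteq> F\<^sub>n\<^sub>-\<^sub>1\<close> for a fixed flag \<open>E\<close>. It is singular only where
  \<open>F\<^sub>1 = E\<^sub>1\<close> and \<open>F\<^sub>n\<^sub>-\<^sub>1 = E\<^sub>n\<^sub>-\<^sub>1\<close>, and there it looks, transversally, like the cone over a quadric of
  dimension \<open>2 * l - 2\<close>, whose primitive cohomology has Poincare polynomial \<open>1 + q\<^bsup>l - 1\<^esup>\<close>. So one
  expects the polynomial at \<open>x\<close> to be \<open>1 + q\<^bsup>l - 1\<^esup>\<close> if \<open>x 1 = 1\<close> and \<open>x n = n\<close>, and \<open>1\<close> for all other
  \<open>x\<close> below \<open>w_perm l\<close>. The permutation \<open>x_perm l\<close> fixes \<open>1\<close> and \<open>n\<close>.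

  The geometry only suggests the family; the proof verifies algebraically that it satisfies the
  conditions of Kazhdan and Lusztig (\<open>is_KL_family_KL_family\<close>) and that at most one family does
  (\<open>is_KL_family_unique\<close>).

  Uniqueness rests on the triangularity of the bar involution (\<open>bar_T_triangular\<close>). To compute with
  that involution one needs the inverses of the standard basis elements. Operators that commute
  with all right multiplications are determined by their value at the unit (\<open>right_linear_eqI\<close>);
  this yields the independence of reduced words and the inverses (\<open>hecke_inverse_T_inv\<close>) without any
  use of the braid relations, and then the compatibility of the bar involution with left
  multiplication by generators (\<open>hecke_bar_gen_mult\<close>).

  For the existence, self-duality is preserved by sums, differences and left multiplication by
  \<open>v\<^sup>-\<^sup>1 (T\<^sub>s + 1)\<close>. Starting from the unit, three-term recursions first produce the sum over the
  parabolic subgroup of all \<open>x\<close> that fix \<open>1\<close> and \<open>n\<close> together with some larger sums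
  (\<open>self_dual_first_le\<close>), and then a chain of elements that ends with the
  wanted one (\<open>self_dual_KL_chain\<close>).
\<close>

(* Keeps the simplifier from turning {1..n} into {Suc 0..n}, which no lemma on permutations of {1..n} matches. *)
declare One_nat_def [simp del]

section \<open>Length and inversions\<close>

definition inversions :: "nat \<Rightarrow> (nat \<Rightarrow> nat) \<Rightarrow> (nat \<times> nat) set" where
  "inversions n w = {(a, b). a \<in> {1..n} \<and> b \<in> {1..n} \<and> a < b \<and> w b < w a}"

lemma finite_inversions [simp]: "finite (inversions n w)"
  by (rule finite_subset[of _ "{1..n} \<times> {1..n}"]) (auto simp: inversions_def)

lemma simple_refl_permutes: "1 \<le> i \<Longrightarrow> i < n \<Longrightarrow> simple_refl i permutes {1..n}"
  unfolding simple_refl_def by (rule permutes_swap_id) auto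

lemma simple_refl_involutory [simp]: "simple_refl i (simple_refl i x) = x"
  by (simp add: simple_refl_def)

lemma simple_refl_cancel_left [simp]: "simple_refl i \<circ> (simple_refl i \<circ> w) = w"
  by (simp add: fun_eq_iff)

lemma simple_refl_cancel_right [simp]: "(w \<circ> simple_refl i) \<circ> simple_refl i = w"
  by (simp add: fun_eq_iff)

lemma simple_refl_comp_permutes_iff [simp]:
  assumes "1 \<le> i" "i < n"
  shows "simple_refl i \<circ> w permutes {1..n} \<longleftrightarrow> w permutes {1..n}"
  using assms by (metis permutes_compose simple_refl_cancel_left simple_refl_permutes)

lemma comp_simple_refl_permutes_iff [simp]:
  assumes "1 \<le> i" "i < n"
  shows "w \<circ> simple_refl i permutes {1..n} \<longleftrightarrow> w permutes {1..n}"
  using assms by (metis permutes_compose simple_refl_cancel_right simple_refl_permutes)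

lemma inv_simple_refl_comp:
  assumes "w permutes S"
  shows "inv (simple_refl i \<circ> w) = inv w \<circ> simple_refl i"
  using assms by (simp add: o_inv_distrib permutes_bij simple_refl_def)

lemma inv_comp_simple_refl:
  assumes "w permutes S"
  shows "inv (w \<circ> simple_refl i) = simple_refl i \<circ> inv w"
  using assms by (simp add: o_inv_distrib permutes_bij simple_refl_def)

lemma simple_refl_apply [simp]:
  "simple_refl i i = Suc i" "simple_refl i (Suc i) = i"
  by (simp_all add: simple_refl_def)

lemma simple_refl_less_iff:
  assumes "\<not> (p = i \<and> q = Suc i)" "\<not> (p = Suc i \<and> q = i)"
  shows "simple_refl i p < simple_refl i q \<longleftrightarrow> p < q"
  using assms
  by (cases "p = i"; cases "p = Suc i"; cases "q = i"; cases "q = Suc i") (auto simp: simple_refl_def)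

lemma inv_neq_Suc:
  assumes "w permutes S"
  shows "inv w i \<noteq> inv w (Suc i)"
  using permutes_inj[OF permutes_inv[OF assms]] by (metis injD n_not_Suc_n)

text \<open>Left multiplication exchanges the values \<open>i\<close> and \<open>i + 1\<close> and leaves all other comparisons
  of entries unchanged.\<close>

lemma inversions_simple_refl_comp:
  assumes w: "w permutes {1..n}" and i: "1 \<le> i" "i < n" and asc: "inv w i < inv w (Suc i)"
  shows "inversions n (simple_refl i \<circ> w) = insert (inv w i, inv w (Suc i)) (inversions n w)"
    and "(inv w i, inv w (Suc i)) \<notin> inversions n w"
proof -
  have wi: "w (inv w x) = x" for x using permutes_inverses(1)[OF w] .
  have iw: "inv w (w x) = x" for x using permutes_inverses(2)[OF w] .
  have eq: "w a = x \<longleftrightarrow> a = inv w x" for a x using wi iw by auto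
  have mem: "inv w i \<in> {1..n}" "inv w (Suc i) \<in> {1..n}"
    using permutes_in_image[OF permutes_inv[OF w]] i by simp_all
  show "(inv w i, inv w (Suc i)) \<notin> inversions n w"
    by (auto simp: inversions_def wi)
  have "(a, b) \<in> inversions n (simple_refl i \<circ> w) \<longleftrightarrow>
        (a, b) \<in> insert (inv w i, inv w (Suc i)) (inversions n w)" for a b
  proof -
    consider "w a = i" "w b = Suc i" | "w a = Suc i" "w b = i"
      | "\<not> (w b = i \<and> w a = Suc i)" "\<not> (w b = Suc i \<and> w a = i)" by blast
    then show ?thesis
    proof cases
      case 1
      then have "a = inv w i" "b = inv w (Suc i)" using eq by blast+
      then show ?thesis using asc mem by (simp add: inversions_def wi)
    next
      case 2
      then have "b = inv w i" "a = inv w (Suc i)" using eq by blast+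
      then show ?thesis using asc by (simp add: inversions_def wi)
    next
      case 3
      then have "(a, b) \<noteq> (inv w i, inv w (Suc i))" using wi by blast
      then show ?thesis
        using simple_refl_less_iff[OF 3] by (auto simp: inversions_def)
    qed
  qed
  then show "inversions n (simple_refl i \<circ> w) = insert (inv w i, inv w (Suc i)) (inversions n w)"
    by auto
qed

lemma card_inversions_ascent:
  assumes "w permutes {1..n}" "1 \<le> i" "i < n" "inv w i < inv w (Suc i)"
  shows "card (inversions n (simple_refl i \<circ> w)) = Suc (card (inversions n w))"
  using inversions_simple_refl_comp[OF assms] by simp

lemma card_inversions_descent:
  assumes "w permutes {1..n}" "1 \<le> i" "i < n" "inv w (Suc i) < inv w i"
  shows "card (inversions n w) = Suc (card (inversions n (simple_refl i \<circ> w)))"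
  using card_inversions_ascent[of "simple_refl i \<circ> w" n i] assms
  by (simp add: inv_simple_refl_comp[OF assms(1)])

text \<open>A map without descents increases strictly, so counting up from \<open>1\<close> gives \<open>k \<le> w k\<close> and counting down
  from \<open>n\<close> gives \<open>w k \<le> k\<close>.\<close>

lemma permutes_no_descent_id:
  assumes w: "w permutes {1..n}" and "\<And>i. 1 \<le> i \<Longrightarrow> i < n \<Longrightarrow> \<not> w (Suc i) < w i"
  shows "w = id"
proof -
  have inj: "w a = w b \<longleftrightarrow> a = b" for a b using permutes_inj[OF w] by (auto dest: injD)
  have lt: "w i < w (Suc i)" if "1 \<le> i" "i < n" for i
    using assms(2)[OF that] inj[of i "Suc i"] by (metis linorder_neqE_nat n_not_Suc_n)
  have ge: "k \<le> w k" if "1 \<le> k" "k \<le> n" for k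
    using that
  proof (induction k)
    case (Suc k)
    show ?case
    proof (cases "k = 0")
      case True
      then show ?thesis using permutes_in_image[OF w, of 1] Suc.prems by (simp add: One_nat_def)
    next
      case False
      then show ?thesis using Suc lt[of k] by force
    qed
  qed simp
  have le: "w (n - k) \<le> n - k" if "k < n" for k
    using that
  proof (induction k)
    case 0
    then show ?case using permutes_in_image[OF w, of n] by simp
  next
    case (Suc k)
    then have "w (n - Suc k) < w (Suc (n - Suc k))" by (intro lt) auto
    moreover have "Suc (n - Suc k) = n - k" using Suc.prems by simp
    ultimately show ?case using Suc by simp
  qed
  show ?thesis
  proof
    fix k show "w k = id k"
    proof (cases "k \<in> {1..n}")
      case True
      then show ?thesis using ge[of k] le[of "n - k"] by fastforce
    next
      case False
      then show ?thesis using permutes_not_in[OF w] by simp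
    qed
  qed
qed

lemma word_prod_Nil [simp]: "word_prod [] = id"
  and word_prod_Cons [simp]: "word_prod (i # is) = simple_refl i \<circ> word_prod is"
  by (simp_all add: word_prod_def)

lemma word_prod_append: "word_prod (is @ js) = word_prod is \<circ> word_prod js"
  by (induction "is") (simp_all add: o_assoc)

lemma word_prod_permutes: "set is \<subseteq> {1..<n} \<Longrightarrow> word_prod is permutes {1..n}"
  by (induction "is") (simp_all add: permutes_id)

lemma card_inversions_word: "set is \<subseteq> {1..<n} \<Longrightarrow> card (inversions n (word_prod is)) \<le> length is"
proof (induction "is")
  case Nil
  have "inversions n id = {}" by (auto simp: inversions_def)
  then show ?case by (simp add: id_def)
next
  case (Cons i js)
  let ?w = "word_prod js"
  have w: "?w permutes {1..n}" using Cons.prems by (intro word_prod_permutes) simp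
  have i: "1 \<le> i" "i < n" and js: "set js \<subseteq> {1..<n}" using Cons.prems by auto
  consider "inv ?w i < inv ?w (Suc i)" | "inv ?w (Suc i) < inv ?w i"
    using inv_neq_Suc[OF w, of i] by linarith
  then show ?case
    using Cons.IH[OF js] card_inversions_ascent[OF w i] card_inversions_descent[OF w i]
    by cases (simp_all del: comp_apply)
qed

lemma exists_word:
  assumes "w permutes {1..n}"
  shows "\<exists>is. set is \<subseteq> {1..<n} \<and> word_prod is = w \<and> length is = card (inversions n w)"
  using assms
proof (induction "card (inversions n w)" arbitrary: w rule: less_induct)
  case less
  show ?case
  proof (cases "inv w = id")
    case True
    then have "w = id" using permutes_inv_inv[OF less.prems] by simp
    moreover have "inversions n id = {}" by (auto simp: inversions_def)
    ultimately show ?thesis by (intro exI[of _ "[]"]) (simp add: id_def)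
  next
    case False
    then obtain i where i: "1 \<le> i" "i < n" and d: "inv w (Suc i) < inv w i"
      using permutes_no_descent_id[OF permutes_inv[OF less.prems]] by blast
    let ?u = "simple_refl i \<circ> w"
    have c: "card (inversions n w) = Suc (card (inversions n ?u))"
      by (rule card_inversions_descent[OF less.prems i d])
    have "?u permutes {1..n}" using less.prems i by simp
    then obtain js where "set js \<subseteq> {1..<n}" "word_prod js = ?u" "length js = card (inversions n ?u)"
      using less.hyps[of ?u] c by auto
    then show ?thesis using i c by (intro exI[of _ "i # js"]) auto
  qed
qed

text \<open>A letter of a word creates at most one inversion, so words are at least as long as the number of
  inversions; removing one left descent after another produces a word of exactly that length.\<close>

lemma coxeter_length_eq:
  assumes "w permutes {1..n}"
  shows "coxeter_length n w = card (inversions n w)"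
  unfolding coxeter_length_def
proof (rule Least_equality)
  show "\<exists>is. set is \<subseteq> {1..<n} \<and> word_prod is = w \<and> length is = card (inversions n w)"
    by (rule exists_word[OF assms])
next
  fix k assume "\<exists>is. set is \<subseteq> {1..<n} \<and> word_prod is = w \<and> length is = k"
  then show "card (inversions n w) \<le> k" using card_inversions_word by blast
qed

lemma reduced_word_exists:
  assumes "w permutes {1..n}"
  obtains "is" where "reduced_word n w is"
  using exists_word[OF assms] coxeter_length_eq[OF assms] by (auto simp: reduced_word_def)

lemma coxeter_length_ascent:
  assumes "w permutes {1..n}" "1 \<le> i" "i < n" "inv w i < inv w (Suc i)"
  shows "coxeter_length n (simple_refl i \<circ> w) = Suc (coxeter_length n w)"
  using assms card_inversions_ascent[OF assms] by (simp add: coxeter_length_eq)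

lemma coxeter_length_descent:
  assumes "w permutes {1..n}" "1 \<le> i" "i < n" "inv w (Suc i) < inv w i"
  shows "coxeter_length n w = Suc (coxeter_length n (simple_refl i \<circ> w))"
  using assms card_inversions_descent[OF assms] by (simp add: coxeter_length_eq)

lemma coxeter_length_id [simp]: "coxeter_length n id = 0"
proof -
  have "inversions n id = {}" by (auto simp: inversions_def)
  then show ?thesis by (simp add: coxeter_length_eq permutes_id)
qed

lemma inv_word_prod: "set is \<subseteq> {1..<n} \<Longrightarrow> inv (word_prod is) = word_prod (rev is)"
proof (induction "is")
  case (Cons i js)
  then show ?case
    using inv_simple_refl_comp[OF word_prod_permutes[of js n]]
    by (simp add: word_prod_append del: comp_apply)
qed (simp add: inv_id)

text \<open>Reading a word backwards inverts its product.\<close>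

lemma coxeter_length_inv:
  assumes "w permutes {1..n}"
  shows "coxeter_length n (inv w) = coxeter_length n w"
proof -
  have le: "coxeter_length n (inv u) \<le> coxeter_length n u" if u: "u permutes {1..n}" for u
  proof -
    obtain "is" where r: "set is \<subseteq> {1..<n}" "word_prod is = u" "length is = coxeter_length n u"
      using reduced_word_exists[OF u] by (auto simp: reduced_word_def)
    have "set (rev is) \<subseteq> {1..<n} \<and> word_prod (rev is) = inv u \<and> length (rev is) = coxeter_length n u"
      using r inv_word_prod[OF r(1)] by simp
    then show ?thesis unfolding coxeter_length_def[of n "inv u"] by (blast intro: Least_le)
  qed
  show ?thesis using le[OF assms] le[OF permutes_inv[OF assms]] permutes_inv_inv[OF assms] by simp
qed

lemma reduced_word_rev:
  assumes "reduced_word n w is"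
  shows "reduced_word n (inv w) (rev is)"
proof -
  have r: "set is \<subseteq> {1..<n}" "word_prod is = w" "length is = coxeter_length n w"
    using assms by (auto simp: reduced_word_def)
  then have "coxeter_length n (inv w) = coxeter_length n w"
    using coxeter_length_inv word_prod_permutes by blast
  then show ?thesis using r inv_word_prod[OF r(1)] by (simp add: reduced_word_def)
qed

text \<open>A tail of a reduced word is reduced, and the first letter is a left descent: otherwise the product
  would be longer than the word.\<close>

lemma reduced_word_Cons:
  assumes r: "reduced_word n w (i # is)"
  shows "1 \<le> i" "i < n" "reduced_word n (simple_refl i \<circ> w) is"
    "coxeter_length n w = Suc (coxeter_length n (simple_refl i \<circ> w))"
    "inv w (Suc i) < inv w i" 
proof -
  show i: "1 \<le> i" "i < n" using r by (auto simp: reduced_word_def)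
  have js: "set is \<subseteq> {1..<n}" and w: "w = simple_refl i \<circ> word_prod is"
    and len: "Suc (length is) = coxeter_length n w"
    using r by (auto simp: reduced_word_def)
  have u: "simple_refl i \<circ> w = word_prod is" by (simp add: w)
  have wp: "w permutes {1..n}" using i word_prod_permutes[OF js] by (simp add: w)
  have le: "coxeter_length n (word_prod is) \<le> length is"
    unfolding coxeter_length_def by (rule Least_le) (use js in auto)
  show d: "inv w (Suc i) < inv w i"
  proof (rule ccontr)
    assume "\<not> ?thesis"
    then have "inv w i < inv w (Suc i)" using inv_neq_Suc[OF wp, of i] by linarith
    from coxeter_length_ascent[OF wp i this] show False using le len u by simp
  qed
  show l: "coxeter_length n w = Suc (coxeter_length n (simple_refl i \<circ> w))"
    by (rule coxeter_length_descent[OF wp i d])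
  show "reduced_word n (simple_refl i \<circ> w) is"
    using l len js u by (simp add: reduced_word_def)
qed

lemma reduced_word_ConsI:
  assumes "w permutes {1..n}" "1 \<le> i" "i < n" "inv w i < inv w (Suc i)" "reduced_word n w is"
  shows "reduced_word n (simple_refl i \<circ> w) (i # is)"
  using assms coxeter_length_ascent[OF assms(1-4)] by (auto simp: reduced_word_def)

section \<open>Laurent polynomials\<close>

lemma v_pow_0 [simp]: "v_pow 0 = 1"
  by (simp add: v_pow_def)

lemma v_pow_mult_v_pow: "v_pow a * v_pow b = v_pow (a + b)"
  by (simp add: v_pow_def mult_single)

lemma v_pow_mult_assoc: "v_pow a * (v_pow b * f) = v_pow (a + b) * f"
  by (simp add: v_pow_mult_v_pow flip: mult.assoc)

lemma lookup_v_pow: "Poly_Mapping.lookup (v_pow k) m = (if m = k then 1 else 0)"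
  by (simp add: v_pow_def lookup_single when_def)

lemma lookup_v_pow_mult: "Poly_Mapping.lookup (v_pow k * f) m = Poly_Mapping.lookup f (m - k)"
proof -
  have *: "m = k + q \<longleftrightarrow> q = m - k" for q by auto
  have **: "Poly_Mapping.lookup (v_pow k) a * c = (c when a = k)" for a c
    by (simp add: lookup_v_pow when_def)
  show ?thesis
    by (simp add: lookup_mult ** *)
qed

lemma lookup_laurent_bar: "Poly_Mapping.lookup (laurent_bar f) m = Poly_Mapping.lookup f (- m)"
  by (simp add: laurent_bar_def map_key.rep_eq inj_def)

lemma laurent_bar_add: "laurent_bar (f + g) = laurent_bar f + laurent_bar g"
  and laurent_bar_diff: "laurent_bar (f - g) = laurent_bar f - laurent_bar g"
  and laurent_bar_0 [simp]: "laurent_bar 0 = 0"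
  by (rule poly_mapping_eqI; simp add: lookup_laurent_bar lookup_add lookup_minus)+

lemma laurent_bar_v_pow_mult: "laurent_bar (v_pow k * f) = v_pow (- k) * laurent_bar f"
  by (rule poly_mapping_eqI) (simp add: lookup_laurent_bar lookup_v_pow_mult)

lemma laurent_bar_v_pow [simp]: "laurent_bar (v_pow k) = v_pow (- k)"
  by (rule poly_mapping_eqI) (auto simp: lookup_laurent_bar lookup_v_pow)

lemma laurent_bar_1 [simp]: "laurent_bar 1 = 1"
  using laurent_bar_v_pow[of 0] by (simp del: laurent_bar_v_pow)

text \<open>Substituting \<open>q = v\<^sup>2\<close> puts the coefficient of index \<open>k\<close> at the exponent \<open>2 * k\<close>. Reading a polynomial
  off exponent by exponent turns degree bounds into statements about where a Laurent polynomial vanishes.\<close>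

lemma lookup_eval_at_q:
  "Poly_Mapping.lookup (eval_at_q p) m = (if even m \<and> 0 \<le> m then coeff p (nat (m div 2)) else 0)"
proof -
  have pow: "v_pow 2 ^ i = v_pow (2 * int i)" for i
    by (induction i) (simp_all add: v_pow_mult_v_pow algebra_simps)
  have "degree (map_poly of_int p :: laurent poly) = degree p"
    by (rule degree_map_poly) simp
  then have "eval_at_q p = (\<Sum>i\<le>degree p. of_int (coeff p i) * v_pow (2 * int i))"
    by (simp add: eval_at_q_def poly_altdef coeff_map_poly pow)
  moreover have "of_int c * v_pow k = Poly_Mapping.single k c" for c k
    unfolding v_pow_def single_of_int[symmetric] mult_single by simp
  ultimately have "Poly_Mapping.lookup (eval_at_q p) m
      = (\<Sum>i\<le>degree p. if 2 * int i = m then coeff p i else 0)"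
    by (simp add: lookup_sum lookup_single when_def)
  also have "\<dots> = (if even m \<and> 0 \<le> m then coeff p (nat (m div 2)) else 0)"
  proof (cases "even m \<and> 0 \<le> m")
    case True
    then have "2 * int i = m \<longleftrightarrow> i = nat (m div 2)" for i by auto
    then show ?thesis using True by (auto simp: coeff_eq_0)
  next
    case False
    then have "2 * int i \<noteq> m" for i by auto
    then show ?thesis using False by (simp del: split_paired_All) (use False in blast)
  qed
  finally show ?thesis .
qed

section \<open>Left and right multiplication by the generators\<close>

lemma finite_perms [simp]: "finite {w. w permutes {1..n::nat}}"
  by (simp add: finite_permutations)

lemma hecke_carrierD: "h \<in> hecke_carrier n \<Longrightarrow> \<not> w permutes {1..n} \<Longrightarrow> h w = 0"
  by (simp add: hecke_carrier_def)

lemma hecke_T_carrier: "w permutes {1..n} \<Longrightarrow> hecke_T w \<in> hecke_carrier n"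
  by (auto simp: hecke_carrier_def hecke_T_def)

text \<open>The coefficient of the product at \<open>z\<close> involves only the two coefficients at \<open>z\<close> and \<open>s\<^sub>i z\<close>, and
  lengths enter only through the relative position of the values \<open>i\<close> and \<open>i + 1\<close>. This form
  needs no sums, and identities between products of generators reduce to it case by case.\<close>

lemma hecke_gen_mult_apply:
  assumes i: "1 \<le> i" "i < n"
  shows "hecke_gen_mult n i h z =
    (if z permutes {1..n} then
       (if inv z (Suc i) < inv z i then h (simple_refl i \<circ> z) + (q_laurent - 1) * h z
        else q_laurent * h (simple_refl i \<circ> z))
     else 0)"
proof -
  let ?s = "simple_refl i"
  have T: "hecke_gen_T n i w z =
      (if w = ?s \<circ> z then (if inv z (Suc i) < inv z i then 1 else q_laurent) else 0)
      + (if w = z then (if inv z (Suc i) < inv z i then q_laurent - 1 else 0) else 0)"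
    if w: "w permutes {1..n}" for w
  proof -
    have flip: "w = ?s \<circ> z \<longleftrightarrow> z = ?s \<circ> w" by (metis simple_refl_cancel_left)
    have iz: "inv z = inv w \<circ> ?s" if "z = ?s \<circ> w"
      using inv_simple_refl_comp[OF w] that by simp
    have ne: "?s \<circ> w \<noteq> w"
    proof
      assume "?s \<circ> w = w"
      then have "?s (w (inv w i)) = w (inv w i)" by (metis comp_apply)
      then show False using permutes_inverses(1)[OF w] by simp
    qed
    consider "inv w i < inv w (Suc i)" | "inv w (Suc i) < inv w i"
      using inv_neq_Suc[OF w, of i] by linarith
    then show ?thesis
    proof cases
      case 1
      then have "coxeter_length n w < coxeter_length n (?s \<circ> w)"
        using coxeter_length_ascent[OF w i] by simp
      with 1 show ?thesis using iz ne unfolding flip by (auto simp: hecke_gen_T_def hecke_T_def)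
    next
      case 2
      then have "\<not> coxeter_length n w < coxeter_length n (?s \<circ> w)"
        using coxeter_length_descent[OF w i] by simp
      with 2 show ?thesis using iz ne unfolding flip by (auto simp: hecke_gen_T_def hecke_T_def)
    qed
  qed
  show ?thesis
  proof (cases "z permutes {1..n}")
    case True
    have sz: "?s \<circ> z permutes {1..n}" using True i by simp
    have "hecke_gen_mult n i h z = (\<Sum>w | w permutes {1..n}.
        (if w = ?s \<circ> z then h w * (if inv z (Suc i) < inv z i then 1 else q_laurent) else 0)
      + (if w = z then h w * (if inv z (Suc i) < inv z i then q_laurent - 1 else 0) else 0))"
      unfolding hecke_gen_mult_def
      by (rule sum.cong) (auto simp: T algebra_simps)
    also have "\<dots> = h (?s \<circ> z) * (if inv z (Suc i) < inv z i then 1 else q_laurent)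
        + h z * (if inv z (Suc i) < inv z i then q_laurent - 1 else 0)"
      using True sz by (simp add: sum.distrib sum.delta)
    finally show ?thesis using True by (simp add: algebra_simps)
  next
    case False
    have "hecke_gen_mult n i h z = 0"
      unfolding hecke_gen_mult_def
    proof (rule sum.neutral, safe)
      fix w assume w: "w permutes {1..n}"
      then have "w \<noteq> z" "w \<noteq> ?s \<circ> z" using False i by auto
      then show "h w * hecke_gen_T n i w z = 0" by (simp add: T[OF w])
    qed
    with False show ?thesis by simp
  qed
qed

text \<open>Multiplication by a generator from the right. It serves to characterise the operators that come from
  left multiplication, so that the braid relations never have to be verified.\<close>

definition right_gen_mult :: "nat \<Rightarrow> nat \<Rightarrow> hecke \<Rightarrow> hecke" where
  "right_gen_mult n i h = (\<lambda>z.
     if z permutes {1..n} then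
       (if z (Suc i) < z i then h (z \<circ> simple_refl i) + (q_laurent - 1) * h z
        else q_laurent * h (z \<circ> simple_refl i))
     else 0)"

text \<open>The coefficients involved are those at \<open>z\<close>, \<open>s\<^sub>i z\<close>, \<open>z s\<^sub>j\<close> and \<open>s\<^sub>i z s\<^sub>j\<close>. Unless the entries of \<open>z\<close> at
  the positions \<open>j\<close> and \<open>j + 1\<close> are the values \<open>i\<close> and \<open>i + 1\<close>, neither multiplication affects the
  descents seen by the other. In the remaining case \<open>s\<^sub>i z = z s\<^sub>j\<close>, and left and
  right multiplication at \<open>z\<close> follow the same rule.\<close>

lemma left_right_gen_mult_commute:
  assumes i: "1 \<le> i" "i < n" and j: "1 \<le> j" "j < n"
  shows "hecke_gen_mult n i (right_gen_mult n j h) = right_gen_mult n j (hecke_gen_mult n i h)"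
proof
  fix z
  let ?s = "simple_refl i" and ?t = "simple_refl j"
  show "hecke_gen_mult n i (right_gen_mult n j h) z = right_gen_mult n j (hecke_gen_mult n i h) z"
  proof (cases "z permutes {1..n}")
    case False
    then show ?thesis by (simp add: hecke_gen_mult_apply[OF i] right_gen_mult_def)
  next
    case z: True
    have zi: "z (inv z x) = x" "inv z (z x) = x" for x
      using permutes_inverses[OF z] by auto
    have perms: "?s \<circ> z permutes {1..n}" "z \<circ> ?t permutes {1..n}" "?s \<circ> (z \<circ> ?t) permutes {1..n}"
      using z i j by simp_all
    have invs: "inv (z \<circ> ?t) = ?t \<circ> inv z" "inv (?s \<circ> z) = inv z \<circ> ?s"
      using inv_comp_simple_refl[OF z] inv_simple_refl_comp[OF z] by auto
    consider (1) "z j = i" "z (Suc j) = Suc i" | (2) "z j = Suc i" "z (Suc j) = i"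
      | (3) "\<not> (z j = i \<and> z (Suc j) = Suc i)" "\<not> (z j = Suc i \<and> z (Suc j) = i)" by blast
    then show ?thesis
    proof cases
      case 3
      have inj: "z a = z b \<longleftrightarrow> a = b" for a b using zi by metis
      have "?t (inv z (Suc i)) < ?t (inv z i) \<longleftrightarrow> inv z (Suc i) < inv z i"
        by (rule simple_refl_less_iff) (use 3 zi in metis)+
      moreover have "?s (z (Suc j)) < ?s (z j) \<longleftrightarrow> z (Suc j) < z j"
        by (rule simple_refl_less_iff) (use 3 in auto)
      ultimately show ?thesis
        using z perms invs
        by (simp add: hecke_gen_mult_apply[OF i] right_gen_mult_def o_assoc algebra_simps)
    next
      case 1
      have iz: "inv z i = j" "inv z (Suc i) = Suc j" using 1 zi by metis+
      have e: "z \<circ> ?t = ?s \<circ> z"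
        using transpose_comp_eq[OF permutes_bij[OF z], of i "Suc i"]
        by (simp add: simple_refl_def iz transpose_commute)
      have e2: "?s \<circ> z \<circ> ?t = z" unfolding e[symmetric] by simp
      from iz show ?thesis
        using z perms invs 1
        by (simp add: hecke_gen_mult_apply[OF i] right_gen_mult_def e e2)
    next
      case 2
      have iz: "inv z i = Suc j" "inv z (Suc i) = j" using 2 zi by metis+
      have e: "z \<circ> ?t = ?s \<circ> z"
        using transpose_comp_eq[OF permutes_bij[OF z], of i "Suc i"]
        by (simp add: simple_refl_def iz transpose_commute)
      have e2: "?s \<circ> z \<circ> ?t = z" unfolding e[symmetric] by simp
      from iz show ?thesis
        using z perms invs 2
        by (simp add: hecke_gen_mult_apply[OF i] right_gen_mult_def e e2)
    qed
  qed
qed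

section \<open>Operators that commute with right multiplication\<close>

text \<open>Endomorphisms of the Hecke algebra as a right module over itself.\<close>

definition right_linear :: "nat \<Rightarrow> (hecke \<Rightarrow> hecke) \<Rightarrow> bool" where
  "right_linear n F \<longleftrightarrow>
     (\<forall>h\<in>hecke_carrier n. F h \<in> hecke_carrier n) \<and>
     (\<forall>g\<in>hecke_carrier n. \<forall>h\<in>hecke_carrier n. F (\<lambda>u. g u + h u) = (\<lambda>u. F g u + F h u)) \<and>
     (\<forall>c. \<forall>h\<in>hecke_carrier n. F (\<lambda>u. c * h u) = (\<lambda>u. c * F h u)) \<and>
     (\<forall>j\<in>{1..<n}. \<forall>h\<in>hecke_carrier n. F (right_gen_mult n j h) = right_gen_mult n j (F h))"

lemma right_linearD:
  assumes "right_linear n F"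
  shows "h \<in> hecke_carrier n \<Longrightarrow> F h \<in> hecke_carrier n"
    and "g \<in> hecke_carrier n \<Longrightarrow> h \<in> hecke_carrier n \<Longrightarrow> F (\<lambda>u. g u + h u) = (\<lambda>u. F g u + F h u)"
    and "h \<in> hecke_carrier n \<Longrightarrow> F (\<lambda>u. c * h u) = (\<lambda>u. c * F h u)"
    and "1 \<le> j \<Longrightarrow> j < n \<Longrightarrow> h \<in> hecke_carrier n \<Longrightarrow>
      F (right_gen_mult n j h) = right_gen_mult n j (F h)"
  using assms by (auto simp: right_linear_def)

lemma hecke_carrier_scale: "h \<in> hecke_carrier n \<Longrightarrow> (\<lambda>u. c * h u) \<in> hecke_carrier n"
  and hecke_carrier_add:
    "g \<in> hecke_carrier n \<Longrightarrow> h \<in> hecke_carrier n \<Longrightarrow> (\<lambda>u. g u + h u) \<in> hecke_carrier n"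
  and hecke_carrier_diff:
    "g \<in> hecke_carrier n \<Longrightarrow> h \<in> hecke_carrier n \<Longrightarrow> (\<lambda>u. g u - h u) \<in> hecke_carrier n"
  and hecke_carrier_sum:
    "(\<And>x. x \<in> A \<Longrightarrow> f x \<in> hecke_carrier n) \<Longrightarrow> (\<lambda>u. \<Sum>x\<in>A. f x u) \<in> hecke_carrier n"
  by (auto simp: hecke_carrier_def)

lemma right_linear_sum:
  assumes F: "right_linear n F" and "finite A" and "\<And>x. x \<in> A \<Longrightarrow> g x \<in> hecke_carrier n"
  shows "F (\<lambda>u. \<Sum>x\<in>A. c x * g x u) = (\<lambda>u. \<Sum>x\<in>A. c x * F (g x) u)"
  using assms(2,3)
proof (induction A rule: finite_induct)
  case empty
  have "(\<lambda>u. 0) \<in> hecke_carrier n" by (simp add: hecke_carrier_def)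
  from right_linearD(3)[OF F this, of 0] show ?case by simp
next
  case (insert a A)
  have "F (\<lambda>u. c a * g a u + (\<Sum>x\<in>A. c x * g x u))
      = (\<lambda>u. F (\<lambda>u. c a * g a u) u + F (\<lambda>u. \<Sum>x\<in>A. c x * g x u) u)"
    using insert.prems
    by (intro right_linearD(2)[OF F] hecke_carrier_scale hecke_carrier_sum) auto
  also have "\<dots> = (\<lambda>u. c a * F (g a) u + (\<Sum>x\<in>A. c x * F (g x) u))"
    using insert.IH insert.prems right_linearD(3)[OF F] by simp
  finally show ?case using insert.hyps by simp
qed

lemma hecke_T_expansion:
  assumes "h \<in> hecke_carrier n"
  shows "h = (\<lambda>u. \<Sum>w | w permutes {1..n}. h w * hecke_T w u)"
proof
  fix u
  have "(\<Sum>w | w permutes {1..n}. h w * hecke_T w u) = (\<Sum>w | w permutes {1..n}. if w = u then h u else 0)"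
    by (rule sum.cong) (auto simp: hecke_T_def)
  also have "\<dots> = h u" using hecke_carrierD[OF assms] by simp
  finally show "h u = (\<Sum>w | w permutes {1..n}. h w * hecke_T w u)" ..
qed

lemma right_gen_mult_T_descent:
  assumes w: "w permutes {1..n}" and j: "1 \<le> j" "j < n" and d: "w (Suc j) < w j"
  shows "right_gen_mult n j (hecke_T (w \<circ> simple_refl j)) = hecke_T w"
proof
  fix z
  let ?t = "simple_refl j"
  have flip: "z \<circ> ?t = w \<circ> ?t \<longleftrightarrow> z = w" "z = w \<circ> ?t \<longleftrightarrow> z \<circ> ?t = w"
    by (metis simple_refl_cancel_right)+
  have "w \<circ> ?t \<noteq> w"
  proof
    assume "w \<circ> ?t = w"
    then have "w (?t j) = w j" by (metis comp_apply)
    with d show False by simp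
  qed
  moreover have "\<not> z (Suc j) < z j" if "z \<circ> ?t = w"
    using d that by auto
  ultimately show "right_gen_mult n j (hecke_T (w \<circ> ?t)) z = hecke_T w z"
    using w d by (auto simp: right_gen_mult_def hecke_T_def flip)
qed

lemma right_linear_eq_T:
  assumes F: "right_linear n F" and G: "right_linear n G" and eq: "F (hecke_T id) = G (hecke_T id)"
  shows "w permutes {1..n} \<Longrightarrow> F (hecke_T w) = G (hecke_T w)"
proof (induction "card (inversions n (inv w))" arbitrary: w rule: less_induct)
  case less
  show ?case
  proof (cases "w = id")
    case False
    then obtain j where j: "1 \<le> j" "j < n" and d: "w (Suc j) < w j"
      using permutes_no_descent_id[OF less.prems] by blast
    let ?u = "w \<circ> simple_refl j"
    have w': "inv w permutes {1..n}" by (rule permutes_inv[OF less.prems])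
    have u: "?u permutes {1..n}" using less.prems j by simp
    have "inv (inv w) (Suc j) < inv (inv w) j"
      using d permutes_inv_inv[OF less.prems] by simp
    from card_inversions_descent[OF w' j this]
    have "card (inversions n (inv ?u)) < card (inversions n (inv w))"
      by (simp add: inv_comp_simple_refl[OF less.prems])
    then have "F (hecke_T ?u) = G (hecke_T ?u)" using less.hyps u by blast
    moreover have "hecke_T w = right_gen_mult n j (hecke_T ?u)"
      using right_gen_mult_T_descent[OF less.prems j d] by simp
    ultimately show ?thesis
      using right_linearD(4)[OF F j] right_linearD(4)[OF G j] hecke_T_carrier[OF u] by simp
  qed (simp add: eq)
qed

text \<open>The unit generates the right regular module, so an endomorphism is determined by its value at
  \<open>T\<^sub>1\<close>. This replaces associativity of the Hecke product: two operators built from left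
  multiplications agree once they agree on \<open>T\<^sub>1\<close>.\<close>

lemma right_linear_eqI:
  assumes F: "right_linear n F" and G: "right_linear n G" and eq: "F (hecke_T id) = G (hecke_T id)"
    and h: "h \<in> hecke_carrier n"
  shows "F h = G h"
proof -
  have "F h = F (\<lambda>u. \<Sum>w | w permutes {1..n}. h w * hecke_T w u)"
    using hecke_T_expansion[OF h] by simp
  also have "\<dots> = (\<lambda>u. \<Sum>w | w permutes {1..n}. h w * F (hecke_T w) u)"
    by (rule right_linear_sum[OF F]) (auto intro: hecke_T_carrier)
  also have "\<dots> = (\<lambda>u. \<Sum>w | w permutes {1..n}. h w * G (hecke_T w) u)"
    using right_linear_eq_T[OF F G eq] by simp
  also have "\<dots> = G (\<lambda>u. \<Sum>w | w permutes {1..n}. h w * hecke_T w u)"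
    by (rule right_linear_sum[OF G, symmetric]) (auto intro: hecke_T_carrier)
  also have "\<dots> = G h"
    using hecke_T_expansion[OF h] by simp
  finally show ?thesis .
qed

text \<open>Multiplication by the inverse \<open>q\<^sup>-\<^sup>1 (T\<^sub>s - (q - 1))\<close> of a generator.\<close>

definition gen_inverse_mult :: "nat \<Rightarrow> nat \<Rightarrow> hecke \<Rightarrow> hecke" where
  "gen_inverse_mult n i h = (\<lambda>u. v_pow (- 2) * (hecke_gen_mult n i h u - (q_laurent - 1) * h u))"

lemma hecke_gen_mult_carrier: "1 \<le> i \<Longrightarrow> i < n \<Longrightarrow> hecke_gen_mult n i h \<in> hecke_carrier n"
  by (auto simp: hecke_carrier_def hecke_gen_mult_apply)

lemma hecke_gen_mult_add:
  assumes "1 \<le> i" "i < n"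
  shows "hecke_gen_mult n i (\<lambda>u. g u + h u) = (\<lambda>u. hecke_gen_mult n i g u + hecke_gen_mult n i h u)"
  by (auto simp: fun_eq_iff hecke_gen_mult_apply[OF assms] algebra_simps)

lemma hecke_gen_mult_scale:
  assumes "1 \<le> i" "i < n"
  shows "hecke_gen_mult n i (\<lambda>u. c * h u) = (\<lambda>u. c * hecke_gen_mult n i h u)"
  by (auto simp: fun_eq_iff hecke_gen_mult_apply[OF assms] algebra_simps)

lemma right_linear_hecke_gen_mult:
  assumes "1 \<le> i" "i < n"
  shows "right_linear n (hecke_gen_mult n i)"
  using assms unfolding right_linear_def
  by (auto simp: hecke_gen_mult_carrier hecke_gen_mult_add hecke_gen_mult_scale
      left_right_gen_mult_commute)

lemma right_linear_gen_inverse_mult: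
  assumes i: "1 \<le> i" "i < n"
  shows "right_linear n (gen_inverse_mult n i)"
proof -
  have "gen_inverse_mult n i h \<in> hecke_carrier n" if "h \<in> hecke_carrier n" for h
    using that hecke_gen_mult_carrier[OF i]
    unfolding gen_inverse_mult_def by (intro hecke_carrier_scale hecke_carrier_diff)
  moreover have "gen_inverse_mult n i (right_gen_mult n j h) = right_gen_mult n j (gen_inverse_mult n i h)"
    if "1 \<le> j" "j < n" for j h
    unfolding gen_inverse_mult_def left_right_gen_mult_commute[OF i that]
    by (auto simp: fun_eq_iff right_gen_mult_def algebra_simps)
  ultimately show ?thesis
    unfolding right_linear_def
    by (auto simp: gen_inverse_mult_def hecke_gen_mult_add[OF i] hecke_gen_mult_scale[OF i] algebra_simps)
qed

lemma right_linear_foldr: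
  assumes "\<And>i. i \<in> set is \<Longrightarrow> right_linear n (f i)"
  shows "right_linear n (foldr f is)"
  using assms
proof (induction "is")
  case Nil
  then show ?case by (simp add: right_linear_def)
next
  case (Cons i "is")
  then have "right_linear n (f i)" "right_linear n (foldr f is)" by auto
  then show ?case unfolding right_linear_def by simp
qed

lemma right_linear_words:
  assumes "set is \<subseteq> {1..<n}"
  shows "right_linear n (foldr (hecke_gen_mult n) is)"
    and "right_linear n (foldr (gen_inverse_mult n) is)"
  using assms
  by (auto intro!: right_linear_foldr right_linear_hecke_gen_mult right_linear_gen_inverse_mult)

lemma hecke_gen_mult_quadratic:
  assumes "1 \<le> i" "i < n" "h \<in> hecke_carrier n"
  shows "hecke_gen_mult n i (hecke_gen_mult n i h)
       = (\<lambda>u. (q_laurent - 1) * hecke_gen_mult n i h u + q_laurent * h u)"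
proof
  fix z
  show "hecke_gen_mult n i (hecke_gen_mult n i h) z
       = (q_laurent - 1) * hecke_gen_mult n i h z + q_laurent * h z"
  proof (cases "z permutes {1..n}")
    case True
    then show ?thesis
      using assms(1,2) inv_neq_Suc[OF True, of i]
      by (cases "inv z (Suc i) < inv z i")
         (auto simp: hecke_gen_mult_apply inv_simple_refl_comp[OF True] algebra_simps)
  next
    case False
    then show ?thesis using assms(1,2) hecke_carrierD[OF assms(3)]
      by (simp add: hecke_gen_mult_apply)
  qed
qed

lemma gen_inverse_mult_inverse:
  assumes i: "1 \<le> i" "i < n" and h: "h \<in> hecke_carrier n"
  shows "gen_inverse_mult n i (hecke_gen_mult n i h) = h"
    and "hecke_gen_mult n i (gen_inverse_mult n i h) = h"
proof -
  show "gen_inverse_mult n i (hecke_gen_mult n i h) = h"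
    unfolding gen_inverse_mult_def hecke_gen_mult_quadratic[OF i h]
    by (simp add: v_pow_mult_assoc)
  have "hecke_gen_mult n i (gen_inverse_mult n i h)
      = (\<lambda>u. v_pow (- 2) * (hecke_gen_mult n i (hecke_gen_mult n i h) u
           - (q_laurent - 1) * hecke_gen_mult n i h u))"
    by (auto simp: fun_eq_iff gen_inverse_mult_def hecke_gen_mult_apply[OF i] algebra_simps)
  then show "hecke_gen_mult n i (gen_inverse_mult n i h) = h"
    unfolding hecke_gen_mult_quadratic[OF i h] by (simp add: v_pow_mult_assoc)
qed

lemma foldr_gen_inverse:
  assumes "set is \<subseteq> {1..<n}" and "h \<in> hecke_carrier n"
  shows "foldr (gen_inverse_mult n) (rev is) (foldr (hecke_gen_mult n) is h) = h"
    and "foldr (hecke_gen_mult n) is (foldr (gen_inverse_mult n) (rev is) h) = h"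
proof -
  show "foldr (gen_inverse_mult n) (rev is) (foldr (hecke_gen_mult n) is h) = h"
    using assms
  proof (induction "is" arbitrary: h)
    case (Cons i js)
    then have "foldr (hecke_gen_mult n) js h \<in> hecke_carrier n"
      by (intro right_linearD(1)[OF right_linear_words(1)]) auto
    then show ?case using Cons by (simp add: gen_inverse_mult_inverse(1))
  qed simp
  show "foldr (hecke_gen_mult n) is (foldr (gen_inverse_mult n) (rev is) h) = h"
    using assms
  proof (induction "is" arbitrary: h)
    case (Cons i js)
    then have "gen_inverse_mult n i h \<in> hecke_carrier n"
      by (intro right_linearD(1)[OF right_linear_gen_inverse_mult]) auto
    then show ?case using Cons by (simp add: gen_inverse_mult_inverse(2))
  qed simp
qed

lemma hecke_gen_mult_T_ascent:
  assumes w: "w permutes {1..n}" and i: "1 \<le> i" "i < n" and asc: "inv w i < inv w (Suc i)"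
  shows "hecke_gen_mult n i (hecke_T w) = hecke_T (simple_refl i \<circ> w)"
proof -
  have "hecke_gen_mult n i (hecke_T w) u = (\<Sum>x | x permutes {1..n}. if x = w then hecke_gen_T n i w u else 0)" for u
    unfolding hecke_gen_mult_def by (rule sum.cong) (auto simp: hecke_T_def)
  then have "hecke_gen_mult n i (hecke_T w) = hecke_gen_T n i w"
    using w by (intro ext) simp
  then show ?thesis using coxeter_length_ascent[OF assms] by (simp add: hecke_gen_T_def)
qed

lemma foldr_reduced_word:
  assumes "reduced_word n w is"
  shows "foldr (hecke_gen_mult n) is (hecke_T id) = hecke_T w"
  using assms
proof (induction "is" arbitrary: w)
  case Nil
  then show ?case by (simp add: reduced_word_def)
next
  case (Cons i js)
  note r = reduced_word_Cons[OF Cons.prems]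
  let ?u = "simple_refl i \<circ> w"
  have u: "?u permutes {1..n}"
    using r(3) word_prod_permutes unfolding reduced_word_def by metis
  then have w: "w permutes {1..n}" using r(1,2) by simp
  have "inv ?u i < inv ?u (Suc i)" using r(5) by (simp add: inv_simple_refl_comp[OF w])
  from hecke_gen_mult_T_ascent[OF u r(1,2) this] show ?case
    using Cons.IH[OF r(3)] by (simp del: comp_apply id_apply add: comp_apply[of "hecke_gen_mult n i"])
qed

section \<open>Inverses of the standard basis\<close>

text \<open>Both sides are module endomorphisms that send \<open>T\<^sub>1\<close> to \<open>T\<^sub>w\<close>, so the choice of the reduced word
  is immaterial.\<close>

lemma hecke_T_mult_eq:
  assumes r: "reduced_word n w is" and h: "h \<in> hecke_carrier n"
  shows "hecke_T_mult n w h = foldr (hecke_gen_mult n) is h"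
proof -
  let ?js = "SOME is. reduced_word n w is"
  have js: "reduced_word n w ?js" using r by (rule someI)
  have "foldr (hecke_gen_mult n) ?js h = foldr (hecke_gen_mult n) is h"
    using r js foldr_reduced_word[OF r] foldr_reduced_word[OF js]
    by (intro right_linear_eqI[OF right_linear_words(1) right_linear_words(1) _ h])
       (auto simp: reduced_word_def)
  then show ?thesis by (simp add: hecke_T_mult_def)
qed

lemma right_linear_hecke_T_mult:
  assumes "w permutes {1..n}"
  shows "right_linear n (hecke_T_mult n w)"
proof -
  have "reduced_word n w (SOME is. reduced_word n w is)"
    using reduced_word_exists[OF assms] by (metis someI)
  then have "set (SOME is. reduced_word n w is) \<subseteq> {1..<n}"
    unfolding reduced_word_def by blast
  then show ?thesis
    unfolding hecke_T_mult_def by (rule right_linear_words(1))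
qed

lemma hecke_T_id_carrier [simp]: "hecke_T id \<in> hecke_carrier n"
  by (rule hecke_T_carrier) (rule permutes_id)

lemma hecke_T_mult_id:
  assumes "w permutes {1..n}"
  shows "hecke_T_mult n w (hecke_T id) = hecke_T w"
  using reduced_word_exists[OF assms] hecke_T_mult_eq[of n w _ "hecke_T id"] foldr_reduced_word
  by (metis hecke_T_id_carrier)

lemma hecke_mult_T:
  assumes w: "w permutes {1..n}"
  shows "hecke_mult n (hecke_T w) h = hecke_T_mult n w h"
proof
  fix u
  have "hecke_mult n (hecke_T w) h u
      = (\<Sum>x | x permutes {1..n}. if x = w then hecke_T_mult n w h u else 0)"
    unfolding hecke_mult_def by (rule sum.cong) (auto simp: hecke_T_def)
  then show "hecke_mult n (hecke_T w) h u = hecke_T_mult n w h u" using w by simp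
qed

lemma right_linear_hecke_mult: "right_linear n (hecke_mult n g)"
  unfolding right_linear_def
proof (intro conjI ballI allI)
  note T = right_linearD[OF right_linear_hecke_T_mult]
  fix h assume h: "h \<in> hecke_carrier n"
  show "hecke_mult n g h \<in> hecke_carrier n"
    unfolding hecke_mult_def
    by (intro hecke_carrier_sum hecke_carrier_scale) (use T(1) h in auto)
  show "hecke_mult n g (\<lambda>u. c * h u) = (\<lambda>u. c * hecke_mult n g h u)" for c
    using T(3) h by (simp add: hecke_mult_def fun_eq_iff sum_distrib_left algebra_simps)
next
  note T = right_linearD[OF right_linear_hecke_T_mult]
  fix g' h assume "g' \<in> hecke_carrier n" "h \<in> hecke_carrier n"
  then show "hecke_mult n g (\<lambda>u. g' u + h u) = (\<lambda>u. hecke_mult n g g' u + hecke_mult n g h u)"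
    using T(2) by (simp add: hecke_mult_def fun_eq_iff sum.distrib algebra_simps)
next
  note T = right_linearD[OF right_linear_hecke_T_mult]
  fix j h assume j: "j \<in> {1..<n}" and h: "h \<in> hecke_carrier n"
  have "hecke_mult n g (right_gen_mult n j h) z
      = (\<Sum>x | x permutes {1..n}. g x * right_gen_mult n j (hecke_T_mult n x h) z)" for z
    unfolding hecke_mult_def using T(4)[of _ n j h] j h by simp
  then show "hecke_mult n g (right_gen_mult n j h) = right_gen_mult n j (hecke_mult n g h)"
    by (auto simp: fun_eq_iff right_gen_mult_def hecke_mult_def sum.distrib sum_distrib_left
        algebra_simps sum_subtractf)
qed

lemma hecke_mult_id:
  assumes "g \<in> hecke_carrier n"
  shows "hecke_mult n g (hecke_T id) = g"
proof -
  have "hecke_mult n g (hecke_T id) = (\<lambda>u. \<Sum>w | w permutes {1..n}. g w * hecke_T w u)"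
    by (simp add: hecke_mult_def hecke_T_mult_id)
  then show ?thesis using hecke_T_expansion[OF assms] by simp
qed

text \<open>If \<open>s\<^sub>1 \<dots> s\<^sub>k\<close> is a reduced word of \<open>w\<close>, then left multiplication by \<open>T\<close> at the inverse of \<open>w\<close> is
  \<open>T\<^sub>s\<^sub>k \<dots> T\<^sub>s\<^sub>1\<close>, which has an obvious inverse operator. Right multiplication is brought back to
  left multiplication by comparing endomorphisms at \<open>T\<^sub>1\<close>.\<close>

lemma hecke_inverse_T_inv:
  assumes r: "reduced_word n w is"
  shows "hecke_inverse n (hecke_T (inv w)) = foldr (gen_inverse_mult n) is (hecke_T id)"
proof -
  let ?b = "foldr (gen_inverse_mult n) is (hecke_T id)"
  let ?x = "inv w"
  have sub: "set is \<subseteq> {1..<n}" "set (rev is) \<subseteq> {1..<n}" using r by (auto simp: reduced_word_def)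
  have w: "w permutes {1..n}" using word_prod_permutes[OF sub(1)] r by (simp add: reduced_word_def)
  then have x: "?x permutes {1..n}" by (rule permutes_inv)
  have rx: "reduced_word n ?x (rev is)" by (rule reduced_word_rev[OF r])
  have b: "?b \<in> hecke_carrier n"
    by (rule right_linearD(1)[OF right_linear_words(2)[OF sub(1)]]) simp
  have mult: "hecke_mult n (hecke_T ?x) h = foldr (hecke_gen_mult n) (rev is) h"
    if "h \<in> hecke_carrier n" for h
    using hecke_mult_T[OF x] hecke_T_mult_eq[OF rx that] by simp
  show ?thesis
    unfolding hecke_inverse_def
  proof (rule the_equality)
    have "hecke_mult n (hecke_T ?x) ?b = hecke_T id"
      using mult[OF b] foldr_gen_inverse(2)[OF sub(2), of "hecke_T id"] by simp
    moreover have "hecke_mult n ?b (hecke_T ?x) = foldr (gen_inverse_mult n) is (hecke_T ?x)"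
      by (rule right_linear_eqI[OF right_linear_hecke_mult right_linear_words(2)[OF sub(1)]])
         (use hecke_mult_id[OF b] hecke_T_carrier[OF x] in auto)
    moreover have "\<dots> = hecke_T id"
      using foldr_gen_inverse(1)[OF sub(2), of "hecke_T id"] foldr_reduced_word[OF rx] by simp
    ultimately show "?b \<in> hecke_carrier n \<and> hecke_mult n (hecke_T ?x) ?b = hecke_T id \<and>
        hecke_mult n ?b (hecke_T ?x) = hecke_T id"
      using b by simp
  next
    fix h
    assume "h \<in> hecke_carrier n \<and> hecke_mult n (hecke_T ?x) h = hecke_T id \<and>
      hecke_mult n h (hecke_T ?x) = hecke_T id"
    then show "h = ?b"
      using mult[of h] foldr_gen_inverse(1)[OF sub(2), of h] by simp
  qed
qed

section \<open>The bar involution\<close>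

text \<open>The image of \<open>T\<^sub>w\<close> under the bar involution.\<close>

definition bar_T :: "nat \<Rightarrow> (nat \<Rightarrow> nat) \<Rightarrow> hecke" where
  "bar_T n w = hecke_inverse n (hecke_T (inv w))"

lemma bar_T_carrier:
  assumes "w permutes {1..n}"
  shows "bar_T n w \<in> hecke_carrier n"
proof -
  obtain "is" where r: "reduced_word n w is" using reduced_word_exists[OF assms] .
  then have "right_linear n (foldr (gen_inverse_mult n) is)"
    by (intro right_linear_words(2)) (simp add: reduced_word_def)
  from right_linearD(1)[OF this, of "hecke_T id"] show ?thesis
    unfolding bar_T_def hecke_inverse_T_inv[OF r] by simp
qed

lemma bar_T_id: "bar_T n id = hecke_T id"
proof -
  have "reduced_word n id []" by (simp add: reduced_word_def)
  from hecke_inverse_T_inv[OF this] show ?thesis by (simp add: bar_T_def)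
qed

lemma bar_T_ascent:
  assumes "w permutes {1..n}" "1 \<le> i" "i < n" "inv w i < inv w (Suc i)"
  shows "bar_T n (simple_refl i \<circ> w) = gen_inverse_mult n i (bar_T n w)"
proof -
  obtain "is" where r: "reduced_word n w is" using reduced_word_exists[OF assms(1)] .
  show ?thesis
    unfolding bar_T_def hecke_inverse_T_inv[OF r]
      hecke_inverse_T_inv[OF reduced_word_ConsI[OF assms r]] by simp
qed

lemma gen_inverse_mult_bar_T_descent:
  assumes w: "w permutes {1..n}" and i: "1 \<le> i" "i < n" and d: "inv w (Suc i) < inv w i"
  shows "gen_inverse_mult n i (bar_T n w)
       = (\<lambda>u. v_pow (- 2) * bar_T n (simple_refl i \<circ> w) u + (v_pow (- 2) - 1) * bar_T n w u)"
proof -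
  let ?u = "simple_refl i \<circ> w"
  have u: "?u permutes {1..n}" using w i by simp
  have "inv ?u i < inv ?u (Suc i)" using d by (simp add: inv_simple_refl_comp[OF w])
  from bar_T_ascent[OF u i this] have "bar_T n w = gen_inverse_mult n i (bar_T n ?u)"
    unfolding simple_refl_cancel_left .
  then have "hecke_gen_mult n i (bar_T n w) = bar_T n ?u"
    using gen_inverse_mult_inverse(2)[OF i bar_T_carrier[OF u]] by simp
  moreover have "v_pow (- 2) * (a - (q_laurent - 1) * b) = v_pow (- 2) * a + (v_pow (- 2) - 1) * b" for a b
  proof -
    have "v_pow (- 2) * (a - (q_laurent - 1) * b)
        = v_pow (- 2) * a - v_pow (- 2) * (q_laurent * b) + v_pow (- 2) * b"
      by (simp add: algebra_simps)
    also have "v_pow (- 2) * (q_laurent * b) = b" by (simp add: v_pow_mult_assoc)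
    finally show ?thesis by (simp add: algebra_simps)
  qed
  ultimately show ?thesis unfolding gen_inverse_mult_def by simp
qed

lemma hecke_bar_eq: "hecke_bar n h = (\<lambda>u. \<Sum>w | w permutes {1..n}. laurent_bar (h w) * bar_T n w u)"
  by (simp add: hecke_bar_def bar_T_def)

lemma hecke_bar_add: "hecke_bar n (\<lambda>u. g u + h u) = (\<lambda>u. hecke_bar n g u + hecke_bar n h u)"
  by (simp add: hecke_bar_eq laurent_bar_add sum.distrib algebra_simps)

lemma hecke_bar_diff: "hecke_bar n (\<lambda>u. g u - h u) = (\<lambda>u. hecke_bar n g u - hecke_bar n h u)"
  by (simp add: hecke_bar_eq laurent_bar_diff sum_subtractf algebra_simps)

lemma hecke_bar_v_pow: "hecke_bar n (\<lambda>u. v_pow k * h u) = (\<lambda>u. v_pow (- k) * hecke_bar n h u)"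
  by (simp add: hecke_bar_eq laurent_bar_v_pow_mult sum_distrib_left algebra_simps)

text \<open>The bar involution is multiplicative as far as left factors \<open>T\<^sub>s\<close> are concerned. In the sum that
  defines it, the terms with coefficient \<open>h (s w)\<close> are reindexed by \<open>w \<mapsto> s w\<close>; what multiplies
  \<open>h w\<close> afterwards is the inverse of \<open>T\<^sub>s\<close> applied to \<open>bar_T n w\<close>, by the quadratic relation if
  \<open>s\<close> is a descent of \<open>w\<close>.\<close>

lemma hecke_bar_gen_mult:
  assumes i: "1 \<le> i" "i < n" and h: "h \<in> hecke_carrier n"
  shows "hecke_bar n (hecke_gen_mult n i h) = gen_inverse_mult n i (hecke_bar n h)"
proof
  fix u
  let ?P = "{w. w permutes {1..n}}" and ?s = "simple_refl i"
  let ?d = "\<lambda>w. inv w (Suc i) < inv w i"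
  have bar: "laurent_bar (hecke_gen_mult n i h w) =
      (if ?d w then 1 else v_pow (- 2)) * laurent_bar (h (?s \<circ> w))
      + (if ?d w then v_pow (- 2) - 1 else 0) * laurent_bar (h w)" if "w \<in> ?P" for w
    using that i
    by (simp add: hecke_gen_mult_apply laurent_bar_add laurent_bar_diff laurent_bar_v_pow_mult
        left_diff_distrib)
  have "hecke_bar n (hecke_gen_mult n i h) u =
      (\<Sum>w\<in>?P. (if ?d w then 1 else v_pow (- 2)) * laurent_bar (h (?s \<circ> w)) * bar_T n w u)
      + (\<Sum>w\<in>?P. (if ?d w then v_pow (- 2) - 1 else 0) * laurent_bar (h w) * bar_T n w u)"
    unfolding hecke_bar_eq sum.distrib[symmetric]
    by (rule sum.cong) (simp_all only: bar distrib_right)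
  also have "(\<Sum>w\<in>?P. (if ?d w then 1 else v_pow (- 2)) * laurent_bar (h (?s \<circ> w)) * bar_T n w u)
      = (\<Sum>w\<in>?P. (if ?d w then v_pow (- 2) else 1) * laurent_bar (h w) * bar_T n (?s \<circ> w) u)"
  proof (rule sum.reindex_bij_witness[of _ "\<lambda>w. ?s \<circ> w" "\<lambda>w. ?s \<circ> w"])
    fix w assume w: "w \<in> ?P"
    then have iw: "inv (?s \<circ> w) = inv w \<circ> ?s" using inv_simple_refl_comp by blast
    have "?d (?s \<circ> w) \<longleftrightarrow> \<not> ?d w" unfolding iw using inv_neq_Suc[of w "{1..n}" i] w by auto
    then show "(if ?d (?s \<circ> w) then v_pow (- 2) else 1) * laurent_bar (h (?s \<circ> w)) * bar_T n (?s \<circ> (?s \<circ> w)) u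
      = (if ?d w then 1 else v_pow (- 2)) * laurent_bar (h (?s \<circ> w)) * bar_T n w u"
      unfolding simple_refl_cancel_left by simp
  qed (use i in auto)
  also have "\<dots> + (\<Sum>w\<in>?P. (if ?d w then v_pow (- 2) - 1 else 0) * laurent_bar (h w) * bar_T n w u)
      = (\<Sum>w\<in>?P. laurent_bar (h w) * gen_inverse_mult n i (bar_T n w) u)"
    unfolding sum.distrib[symmetric]
  proof (rule sum.cong[OF refl])
    fix w assume "w \<in> ?P"
    then have w: "w permutes {1..n}" by simp
    consider "?d w" | "inv w i < inv w (Suc i)" using inv_neq_Suc[OF w, of i] by linarith
    then show "(if ?d w then v_pow (- 2) else 1) * laurent_bar (h w) * bar_T n (?s \<circ> w) u
        + (if ?d w then v_pow (- 2) - 1 else 0) * laurent_bar (h w) * bar_T n w u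
      = laurent_bar (h w) * gen_inverse_mult n i (bar_T n w) u"
    proof cases
      case 1
      then show ?thesis
        unfolding gen_inverse_mult_bar_T_descent[OF w i 1] by (simp add: algebra_simps)
    next
      case 2
      then show ?thesis unfolding bar_T_ascent[OF w i 2] by simp
    qed
  qed
  also have "\<dots> = gen_inverse_mult n i (hecke_bar n h) u"
    unfolding hecke_bar_eq
    by (subst right_linear_sum[OF right_linear_gen_inverse_mult[OF i]]) (auto intro: bar_T_carrier)
  finally show "hecke_bar n (hecke_gen_mult n i h) u = gen_inverse_mult n i (hecke_bar n h) u" .
qed

text \<open>Each inverse generator lengthens the support by at most one, and reaches the top coefficient only
  through the term \<open>q\<^sup>-\<^sup>1 T\<^sub>s\<close>.\<close>

lemma bar_T_triangular:
  assumes "y permutes {1..n}" "z permutes {1..n}" "coxeter_length n y \<le> coxeter_length n z"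
  shows "bar_T n y z = (if z = y then v_pow (- 2 * int (coxeter_length n y)) else 0)"
  using assms
proof (induction "coxeter_length n y" arbitrary: y z rule: less_induct)
  case less
  note y = less.prems(1) and z = less.prems(2)
  show ?case
  proof (cases "inv y = id")
    case True
    then have "y = id" using permutes_inv_inv[OF y] by simp
    then show ?thesis unfolding \<open>y = id\<close> bar_T_id by (simp add: hecke_T_def)
  next
    case False
    then obtain i where i: "1 \<le> i" "i < n" and d: "inv y (Suc i) < inv y i"
      using permutes_no_descent_id[OF permutes_inv[OF y]] by blast
    let ?s = "simple_refl i"
    let ?u = "?s \<circ> y"
    have len: "coxeter_length n y = Suc (coxeter_length n ?u)"
      by (rule coxeter_length_descent[OF y i d])
    have u: "?u permutes {1..n}" using y i by simp
    have sz: "?s \<circ> z permutes {1..n}" using z i by simp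
    have "inv ?u i < inv ?u (Suc i)" using d by (simp add: inv_simple_refl_comp[OF y])
    from bar_T_ascent[OF u i this] have Y: "bar_T n y = gen_inverse_mult n i (bar_T n ?u)"
      unfolding simple_refl_cancel_left .
    have IH: "bar_T n ?u x = (if x = ?u then v_pow (- 2 * int (coxeter_length n ?u)) else 0)"
      if "x permutes {1..n}" "coxeter_length n ?u \<le> coxeter_length n x" for x
      using less.hyps[OF _ u that] len by simp
    have uz: "bar_T n ?u z = 0"
      using IH[OF z] less.prems(3) len by auto
    have flip: "?s \<circ> z = ?u \<longleftrightarrow> z = y" by (metis simple_refl_cancel_left)
    consider (1) "inv z (Suc i) < inv z i" | (2) "inv z i < inv z (Suc i)"
      using inv_neq_Suc[OF z, of i] by linarith
    then show ?thesis
    proof cases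
      case 1
      then have "coxeter_length n ?u \<le> coxeter_length n (?s \<circ> z)"
        using coxeter_length_descent[OF z i] less.prems(3) len by simp
      with IH[OF sz] 1 z show ?thesis
        unfolding Y gen_inverse_mult_def hecke_gen_mult_apply[OF i] uz flip
        by (simp add: len v_pow_mult_v_pow)
    next
      case 2
      then have "coxeter_length n ?u < coxeter_length n (?s \<circ> z)"
        using coxeter_length_ascent[OF z i] less.prems(3) len by simp
      moreover from this have "z \<noteq> y" using flip by auto
      ultimately have "bar_T n ?u (?s \<circ> z) = 0" using IH[OF sz] flip by auto
      with 2 \<open>z \<noteq> y\<close> show ?thesis
        unfolding Y gen_inverse_mult_def hecke_gen_mult_apply[OF i] uz by simp
    qed
  qed
qed

section \<open>Uniqueness of Kazhdan--Lusztig families\<close>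

lemma lookup_hecke_of_polys:
  "Poly_Mapping.lookup (hecke_of_polys n w p x) m =
     Poly_Mapping.lookup (eval_at_q (p x)) (m + int (coxeter_length n w))"
  by (simp add: hecke_of_polys_def lookup_v_pow_mult)

text \<open>The degree bound says that \<open>v\<^bsup>l(x)\<^esup>\<close> times the coefficient at \<open>x\<close> has only negative exponents.\<close>

lemma hecke_of_polys_degree:
  assumes "is_KL_family n w p" "x \<noteq> w" "- int (coxeter_length n x) \<le> m"
  shows "Poly_Mapping.lookup (hecke_of_polys n w p x) m = 0"
proof (cases "bruhat_le n x w")
  case True
  then have deg: "real (degree (p x)) \<le> (real (coxeter_length n w) - real (coxeter_length n x) - 1) / 2"
    using assms(1,2) by (simp add: is_KL_family_def)
  let ?k = "m + int (coxeter_length n w)"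
  show ?thesis
  proof (cases "even ?k \<and> 0 \<le> ?k")
    case True
    have "2 * real (degree (p x)) + real (coxeter_length n x) + 1 \<le> real (coxeter_length n w)"
      using deg by (simp add: field_simps)
    then have "2 * degree (p x) + coxeter_length n x + 1 \<le> coxeter_length n w"
      by linarith
    moreover obtain j where j: "?k = 2 * j" using True by blast
    ultimately have "degree (p x) < nat j"
      using assms(3) by linarith
    then have "degree (p x) < nat (?k div 2)" using j by simp
    then show ?thesis using True by (simp add: lookup_hecke_of_polys lookup_eval_at_q coeff_eq_0)
  qed (auto simp: lookup_hecke_of_polys lookup_eval_at_q)
next
  case False
  then have "p x = 0" using assms(1) by (simp add: is_KL_family_def)
  then show ?thesis by (simp add: lookup_hecke_of_polys lookup_eval_at_q)
qed

text \<open>Let \<open>x\<close> be of maximal length with different polynomials. Triangularity of the bar involution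
  shows that \<open>v\<^bsup>l(x)\<^esup>\<close> times the difference of the coefficients at \<open>x\<close> is symmetric under
  \<open>v \<mapsto> v\<^sup>-\<^sup>1\<close>; but it has only negative exponents, so it vanishes.\<close>

lemma is_KL_family_unique:
  assumes p: "is_KL_family n w p" and p': "is_KL_family n w p'"
  shows "p = p'"
proof (rule ccontr)
  assume ne: "p \<noteq> p'"
  let ?l = "coxeter_length n"
  define d where "d = (\<lambda>x. hecke_of_polys n w p x - hecke_of_polys n w p' x)"
  define X where "X = {x. p x \<noteq> p' x}"
  have zero: "p x = 0" "p' x = 0" if "\<not> x permutes {1..n}" for x
    using p p' that by (auto simp: is_KL_family_def bruhat_le_def)
  then have sub: "X \<subseteq> {x. x permutes {1..n}}" by (force simp: X_def)
  then have "finite X" by (rule finite_subset) simp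
  moreover have "X \<noteq> {}" using ne by (auto simp: X_def)
  ultimately have "Max (?l ` X) \<in> ?l ` X" by (intro Max_in) auto
  then obtain x where x: "x \<in> X" and lx: "Max (?l ` X) = ?l x" by blast
  have max: "?l y \<le> ?l x" if "y \<in> X" for y
    using Max_ge[of "?l ` X" "?l y"] that \<open>finite X\<close> lx by simp
  have xp: "x permutes {1..n}" using x sub by auto
  have d0: "d y = 0" if "y \<notin> X" for y
    using that by (simp add: d_def X_def hecke_of_polys_def)
  have "hecke_bar n d = d"
    using p p' unfolding d_def hecke_bar_diff by (simp add: is_KL_family_def)
  then have "d x = (\<Sum>y | y permutes {1..n}. laurent_bar (d y) * bar_T n y x)"
    unfolding hecke_bar_eq by (metis (no_types, lifting))
  also have "\<dots> = (\<Sum>y | y permutes {1..n}. if y = x then laurent_bar (d x) * v_pow (- 2 * int (?l x)) else 0)"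
  proof (rule sum.cong[OF refl])
    fix y assume "y \<in> {y. y permutes {1..n}}"
    then have y: "y permutes {1..n}" by simp
    show "laurent_bar (d y) * bar_T n y x =
        (if y = x then laurent_bar (d x) * v_pow (- 2 * int (?l x)) else 0)"
    proof (cases "y \<in> X")
      case True
      then show ?thesis using bar_T_triangular[OF y xp] max by auto
    next
      case False
      then show ?thesis using x d0 by auto
    qed
  qed
  also have "\<dots> = v_pow (- 2 * int (?l x)) * laurent_bar (d x)" using xp by simp
  finally have sym: "Poly_Mapping.lookup (d x) m = Poly_Mapping.lookup (d x) (- m - 2 * int (?l x))" for m
    using lookup_v_pow_mult lookup_laurent_bar by (metis add.commute diff_minus_eq_add minus_add_distrib mult_minus_left uminus_add_conv_diff)
  have "x \<noteq> w" using x p p' by (auto simp: X_def is_KL_family_def)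
  then have hi: "Poly_Mapping.lookup (d x) m = 0" if "- int (?l x) \<le> m" for m
    using hecke_of_polys_degree[OF p _ that] hecke_of_polys_degree[OF p' _ that]
    by (simp add: d_def lookup_minus)
  have all: "Poly_Mapping.lookup (d x) m = 0" for m
    using hi[of m] hi[of "- m - 2 * int (?l x)"] sym[of m] by linarith
  have "coeff (p x) k = coeff (p' x) k" for k
    using all[of "2 * int k - int (?l w)"]
    by (simp add: d_def lookup_minus lookup_hecke_of_polys lookup_eval_at_q)
  then have "p x = p' x" by (simp add: poly_eq_iff)
  with x show False by (simp add: X_def)
qed

lemma KL_poly_eqI:
  assumes "is_KL_family n w p"
  shows "KL_poly n x w = p x"
proof -
  have "(THE p. is_KL_family n w p) = p"
    using assms is_KL_family_unique by (blast intro: the_equality)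
  then show ?thesis by (simp add: KL_poly_def)
qed

section \<open>Self-dual elements\<close>

text \<open>The exponent \<open>N\<close> is kept apart from the element, so that the elements themselves are sums of
  basis elements with coefficients in \<open>\<int>[q]\<close>.\<close>

definition self_dual :: "nat \<Rightarrow> int \<Rightarrow> hecke \<Rightarrow> bool" where
  "self_dual n N h \<longleftrightarrow> h \<in> hecke_carrier n \<and>
     hecke_bar n (\<lambda>u. v_pow (- N) * h u) = (\<lambda>u. v_pow (- N) * h u)"

lemma self_dual_iff:
  "self_dual n N h \<longleftrightarrow> h \<in> hecke_carrier n \<and> hecke_bar n h = (\<lambda>u. v_pow (- 2 * N) * h u)"
proof -
  have "(\<lambda>u. v_pow N * hecke_bar n h u) = (\<lambda>u. v_pow (- N) * h u) \<longleftrightarrow>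
        hecke_bar n h = (\<lambda>u. v_pow (- 2 * N) * h u)" (is "?A \<longleftrightarrow> ?B")
  proof
    assume A: ?A
    have "hecke_bar n h u = v_pow (- 2 * N) * h u" for u
    proof -
      have "hecke_bar n h u = v_pow (- N) * (v_pow N * hecke_bar n h u)"
        unfolding v_pow_mult_assoc by simp
      also have "\<dots> = v_pow (- N) * (v_pow (- N) * h u)"
        by (simp only: fun_cong[OF A])
      finally show ?thesis by (simp add: v_pow_mult_assoc)
    qed
    then show ?B by blast
  next
    assume ?B
    then show ?A by (simp add: v_pow_mult_assoc)
  qed
  then show ?thesis by (simp add: self_dual_def hecke_bar_v_pow)
qed

lemma self_dual_add:
  "self_dual n N g \<Longrightarrow> self_dual n N h \<Longrightarrow> self_dual n N (\<lambda>u. g u + h u)"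
  by (simp add: self_dual_iff hecke_bar_add hecke_carrier_add algebra_simps)

lemma self_dual_diff:
  "self_dual n N g \<Longrightarrow> self_dual n N h \<Longrightarrow> self_dual n N (\<lambda>u. g u - h u)"
  by (simp add: self_dual_iff hecke_bar_diff hecke_carrier_diff algebra_simps)

lemma self_dual_shift:
  "self_dual n N h \<Longrightarrow> self_dual n (N + 2) (\<lambda>u. q_laurent * h u)"
  by (simp add: self_dual_iff hecke_bar_v_pow hecke_carrier_scale v_pow_mult_assoc)

text \<open>Left multiplication by the self-dual element \<open>v\<^sup>-\<^sup>1 (T\<^sub>s + 1)\<close>.\<close>

lemma self_dual_gen_mult:
  assumes i: "1 \<le> i" "i < n" and h: "self_dual n N h"
  shows "self_dual n (N + 1) (\<lambda>u. hecke_gen_mult n i h u + h u)"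
proof -
  have hc: "h \<in> hecke_carrier n" and hb: "hecke_bar n h = (\<lambda>u. v_pow (- 2 * N) * h u)"
    using h by (auto simp: self_dual_iff)
  have "gen_inverse_mult n i (\<lambda>u. v_pow (- 2 * N) * h u)
      = (\<lambda>u. v_pow (- 2 * N) * gen_inverse_mult n i h u)"
    by (rule right_linearD(3)[OF right_linear_gen_inverse_mult[OF i] hc])
  then have "hecke_bar n (\<lambda>u. hecke_gen_mult n i h u + h u)
      = (\<lambda>u. v_pow (- 2 * N) * gen_inverse_mult n i h u + v_pow (- 2 * N) * h u)"
    unfolding hecke_bar_add hecke_bar_gen_mult[OF i hc] hb by simp
  also have "\<dots> = (\<lambda>u. v_pow (- 2 * (N + 1)) * (hecke_gen_mult n i h u + h u))"
    by (simp add: gen_inverse_mult_def fun_eq_iff algebra_simps v_pow_mult_assoc v_pow_mult_v_pow)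
  finally show ?thesis
    using hecke_gen_mult_carrier[OF i] hc by (simp add: self_dual_iff hecke_carrier_add)
qed

lemma self_dual_id: "self_dual n 0 (hecke_T id)"
proof -
  have "hecke_bar n (hecke_T id) = (\<lambda>u. \<Sum>w | w permutes {1..n}. if w = id then bar_T n id u else 0)"
    unfolding hecke_bar_eq by (intro ext sum.cong) (auto simp: hecke_T_def)
  also have "\<dots> = hecke_T id" unfolding bar_T_id by simp
  finally show ?thesis by (simp add: self_dual_iff)
qed

section \<open>Sums of standard basis elements\<close>

definition T_sum :: "(nat \<Rightarrow> nat) set \<Rightarrow> hecke" where
  "T_sum S = (\<lambda>x. if x \<in> S then 1 else 0)"

lemma gen_mult_T_sum_stable:
  assumes i: "1 \<le> i" "i < n" and S: "S \<subseteq> {x. x permutes {1..n}}"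
    and stable: "\<And>x. x \<in> S \<Longrightarrow> simple_refl i \<circ> x \<in> S"
  shows "hecke_gen_mult n i (T_sum S) = (\<lambda>u. q_laurent * T_sum S u)"
proof
  fix z
  have "simple_refl i \<circ> z \<in> S \<longleftrightarrow> z \<in> S" using stable by (metis simple_refl_cancel_left)
  then show "hecke_gen_mult n i (T_sum S) z = q_laurent * T_sum S z"
    using S by (auto simp: hecke_gen_mult_apply[OF i] T_sum_def)
qed

lemma gen_mult_T_sum_ascent:
  assumes i: "1 \<le> i" "i < n" and S: "S \<subseteq> {x. x permutes {1..n}}"
    and asc: "\<And>x. x \<in> S \<Longrightarrow> inv x i < inv x (Suc i)"
  shows "hecke_gen_mult n i (T_sum S) = T_sum {x. simple_refl i \<circ> x \<in> S}"
proof
  fix z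
  show "hecke_gen_mult n i (T_sum S) z = T_sum {x. simple_refl i \<circ> x \<in> S} z"
  proof (cases "z permutes {1..n}")
    case z: True
    consider "inv z (Suc i) < inv z i" | "inv z i < inv z (Suc i)"
      using inv_neq_Suc[OF z, of i] by linarith
    then show ?thesis
    proof cases
      case 1
      then have "z \<notin> S" using asc by force
      with 1 z show ?thesis by (auto simp: hecke_gen_mult_apply[OF i] T_sum_def)
    next
      case 2
      have "simple_refl i \<circ> z \<notin> S"
        using asc[of "simple_refl i \<circ> z"] 2 by (auto simp: inv_simple_refl_comp[OF z])
      with 2 z show ?thesis by (auto simp: hecke_gen_mult_apply[OF i] T_sum_def)
    qed
  next
    case False
    then have "simple_refl i \<circ> z \<notin> S" using S i by auto
    with False show ?thesis by (simp add: hecke_gen_mult_apply[OF i] T_sum_def)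
  qed
qed

lemma T_sum_Un:
  "S \<inter> S' = {} \<Longrightarrow> T_sum (S \<union> S') = (\<lambda>u. T_sum S u + T_sum S' u)"
  by (auto simp: T_sum_def fun_eq_iff)

text \<open>Every set of permutations met below splits into pairs \<open>{x, s x}\<close>, on which \<open>T\<^sub>s + 1\<close> acts by
  \<open>q + 1\<close>, and elements \<open>x\<close> with \<open>s x\<close> longer, to which \<open>T\<^sub>s + 1\<close> adds \<open>s x\<close>.\<close>

lemma gen_mult_T_sum:
  assumes i: "1 \<le> i" "i < n" and perms: "S0 \<union> S1 \<subseteq> {x. x permutes {1..n}}" and disj: "S0 \<inter> S1 = {}"
    and stable: "\<And>x. x \<in> S0 \<Longrightarrow> simple_refl i \<circ> x \<in> S0"
    and asc: "\<And>x. x \<in> S1 \<Longrightarrow> inv x i < inv x (Suc i)"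
  shows "(\<lambda>u. hecke_gen_mult n i (T_sum (S0 \<union> S1)) u + T_sum (S0 \<union> S1) u)
       = (\<lambda>u. (q_laurent + 1) * T_sum S0 u + T_sum S1 u + T_sum {x. simple_refl i \<circ> x \<in> S1} u)"
proof -
  have "hecke_gen_mult n i (T_sum (S0 \<union> S1))
      = (\<lambda>u. hecke_gen_mult n i (T_sum S0) u + hecke_gen_mult n i (T_sum S1) u)"
    unfolding T_sum_Un[OF disj] by (rule hecke_gen_mult_add[OF i])
  also have "\<dots> = (\<lambda>u. q_laurent * T_sum S0 u + T_sum {x. simple_refl i \<circ> x \<in> S1} u)"
    using gen_mult_T_sum_stable[OF i, of S0] gen_mult_T_sum_ascent[OF i, of S1] perms stable asc
    by simp
  finally show ?thesis
    unfolding T_sum_Un[OF disj] by (simp add: algebra_simps)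
qed

section \<open>The sum over a parabolic subgroup\<close>

text \<open>The length of the longest permutation of \<open>m\<close> letters, as an integer so that exponents can be
  subtracted.\<close>

definition triangle :: "nat \<Rightarrow> int" where
  "triangle m = (\<Sum>i<m. int i)"

lemma triangle_0 [simp]: "triangle 0 = 0" and triangle_Suc [simp]: "triangle (Suc m) = triangle m + int m"
  by (simp_all add: triangle_def)

text \<open>The permutations of \<open>{r..<n}\<close> form a parabolic subgroup. As \<open>k\<close> runs from \<open>r\<close> to \<open>n - 1\<close>, these
  sets interpolate between the subgroup for \<open>r + 1\<close> and the one for \<open>r\<close>.\<close>

definition first_le :: "nat \<Rightarrow> nat \<Rightarrow> nat \<Rightarrow> (nat \<Rightarrow> nat) set" where
  "first_le n r k = {x. x permutes {r..<n} \<and> x r \<le> k}"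

lemma first_le_permutes: "1 \<le> r \<Longrightarrow> first_le n r k \<subseteq> {x. x permutes {1..n}}"
  unfolding first_le_def by (auto elim!: permutes_subset)

text \<open>The elements with \<open>x r < k\<close> are permuted by \<open>s\<^sub>k\<close>, and those with \<open>x r = k\<close> are moved up to
  \<open>x r = k + 1\<close>, so \<open>T\<^sub>s + 1\<close> produces the next sum and \<open>q\<close> times the previous one.\<close>

lemma first_le_step:
  assumes r: "1 \<le> r" "r \<le> k" and k: "Suc k < n"
  shows "T_sum (first_le n r (Suc k)) =
    (\<lambda>u. (hecke_gen_mult n k (T_sum (first_le n r k)) u + T_sum (first_le n r k) u)
       - q_laurent * T_sum (first_le n r (k - 1)) u)"
proof -
  let ?s = "simple_refl k"
  let ?S1 = "{x. x permutes {r..<n} \<and> x r = k}"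
  have i: "1 \<le> k" "k < n" using r k by auto
  have s: "?s permutes {r..<n}" unfolding simple_refl_def using r k by (intro permutes_swap_id) auto
  have perm: "?s \<circ> x permutes {r..<n} \<longleftrightarrow> x permutes {r..<n}" for x
    using s by (metis permutes_compose simple_refl_cancel_left)
  have split: "first_le n r k = first_le n r (k - 1) \<union> ?S1"
    using i by (auto simp: first_le_def)
  have eq: "(\<lambda>u. hecke_gen_mult n k (T_sum (first_le n r k)) u + T_sum (first_le n r k) u)
     = (\<lambda>u. (q_laurent + 1) * T_sum (first_le n r (k - 1)) u + T_sum ?S1 u + T_sum {x. ?s \<circ> x \<in> ?S1} u)"
    unfolding split
  proof (rule gen_mult_T_sum[OF i])
    show "first_le n r (k - 1) \<union> ?S1 \<subseteq> {x. x permutes {1..n}}"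
      unfolding split[symmetric] by (rule first_le_permutes[OF r(1)])
    show "first_le n r (k - 1) \<inter> ?S1 = {}" using i by (auto simp: first_le_def)
    show "?s \<circ> x \<in> first_le n r (k - 1)" if "x \<in> first_le n r (k - 1)" for x
    proof -
      have "x permutes {r..<n}" "x r \<le> k - 1" using that by (auto simp: first_le_def)
      moreover from this have "?s (x r) = x r" using i by (auto simp: simple_refl_def transpose_def)
      ultimately show ?thesis by (simp add: first_le_def perm)
    qed
    show "inv x k < inv x (Suc k)" if "x \<in> ?S1" for x
    proof -
      have x: "x permutes {r..<n}" "x r = k" using that by auto
      then have "inv x k = r" using permutes_inverses(2)[OF x(1)] by metis
      moreover have "inv x (Suc k) \<in> {r..<n}"
        using permutes_in_image[OF permutes_inv[OF x(1)]] r k by simp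
      moreover have "inv x k \<noteq> inv x (Suc k)" by (rule inv_neq_Suc[OF x(1)])
      ultimately show ?thesis by simp
    qed
  qed
  have "?s (x r) = k \<longleftrightarrow> x r = Suc k" for x :: "nat \<Rightarrow> nat"
    by (auto simp: simple_refl_def transpose_def)
  then have S1': "{x. ?s \<circ> x \<in> ?S1} = {x. x permutes {r..<n} \<and> x r = Suc k}"
    using perm by auto
  have "T_sum (first_le n r (Suc k)) u = T_sum (first_le n r (k - 1)) u + T_sum ?S1 u
      + T_sum {x. x permutes {r..<n} \<and> x r = Suc k} u" for u
    using i by (auto simp: T_sum_def first_le_def)
  note split3 = this
  show ?thesis
  proof
    fix u
    show "T_sum (first_le n r (Suc k)) u =
      (hecke_gen_mult n k (T_sum (first_le n r k)) u + T_sum (first_le n r k) u)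
       - q_laurent * T_sum (first_le n r (k - 1)) u"
      unfolding split3 fun_cong[OF eq] S1' by (simp add: algebra_simps)
  qed
qed

lemma first_le_diagonal:
  assumes "Suc r < n"
  shows "first_le n r r = first_le n (Suc r) (n - 1)"
proof -
  have "x permutes {Suc r..<n}" if x: "x permutes {r..<n}" "x r \<le> r" for x
  proof (rule permutes_superset[OF x(1)])
    have "x r \<in> {r..<n}" using permutes_in_image[OF x(1)] assms by simp
    then have "x r = r" using x(2) by simp
    moreover have "y = r" if "y \<in> {r..<n} - {Suc r..<n}" for y using that by auto
    ultimately show "x y = y" if "y \<in> {r..<n} - {Suc r..<n}" for y using that by metis
  qed
  moreover have "x permutes {r..<n} \<and> x r \<le> r \<and> x (Suc r) \<le> n - 1" if x: "x permutes {Suc r..<n}" for x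
    using permutes_subset[OF x, of "{r..<n}"] permutes_not_in[OF x, of r]
      permutes_in_image[OF x, of "Suc r"] assms by auto
  moreover have "x (Suc r) \<le> n - 1" if x: "x permutes {r..<n}" for x
    using permutes_in_image[OF x, of "Suc r"] assms by auto
  ultimately show ?thesis by (auto simp: first_le_def)
qed

lemma self_dual_zero: "self_dual n N (\<lambda>u. 0)"
  by (simp add: self_dual_iff hecke_carrier_def hecke_bar_eq)

text \<open>The smallest of these sets for \<open>r\<close> is the largest one for \<open>r + 1\<close>, so an induction on \<open>k\<close> that
  carries two consecutive sums is nested in a downward induction on \<open>r\<close>.\<close>

lemma self_dual_first_le:
  assumes "1 \<le> r" "r \<le> k" "k < n"
  shows "self_dual n (triangle (n - r - 1) + int (k - r)) (T_sum (first_le n r k))"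
  using assms
proof (induction "n - r" arbitrary: r k rule: less_induct)
  case less
  let ?N = "triangle (n - r - 1)"
  have base: "self_dual n ?N (T_sum (first_le n r r))"
  proof (cases "Suc r < n")
    case True
    have "self_dual n (triangle (n - Suc r - 1) + int (n - 1 - Suc r)) (T_sum (first_le n (Suc r) (n - 1)))"
      using less.prems True by (intro less.hyps) auto
    moreover have "n - r - 1 = Suc (n - Suc r - 1)" using True by simp
    ultimately show ?thesis unfolding first_le_diagonal[OF True] by simp
  next
    case False
    then have n: "n = Suc r" using less.prems by simp
    have "x permutes {r..<Suc r} \<longleftrightarrow> x = id" for x :: "nat \<Rightarrow> nat" by simp
    then have "T_sum (first_le n r r) = hecke_T id"
      unfolding n by (auto simp: T_sum_def first_le_def hecke_T_def fun_eq_iff)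
    then show ?thesis using self_dual_id unfolding n by simp
  qed
  have "self_dual n (?N + int m) (T_sum (first_le n r (r + m))) \<and>
      self_dual n (?N + int m - 1) (T_sum (first_le n r (r + m - 1)))" if "r + m < n" for m
    using that
  proof (induction m)
    case 0
    \<comment> \<open>Here \<open>r - 1\<close> is a true predecessor since \<open>1 \<le> r\<close>, and no value of a permutation of \<open>{r..<n}\<close> at \<open>r\<close> lies below \<open>r\<close>.\<close>
    have "first_le n r (r - 1) = {}"
    proof -
      have "r \<le> x r" if "x permutes {r..<n}" for x
        using permutes_in_image[OF that, of r] less.prems by simp
      then show ?thesis using less.prems by (fastforce simp: first_le_def)
    qed
    then have "T_sum (first_le n r (r - 1)) = (\<lambda>u. 0)" by (simp add: T_sum_def)
    then show ?case using base self_dual_zero by simp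
  next
    case (Suc m)
    let ?k = "r + m"
    have 1: "self_dual n (?N + int m) (T_sum (first_le n r ?k))"
      and 2: "self_dual n (?N + int m - 1) (T_sum (first_le n r (?k - 1)))"
      using Suc by auto
    have "self_dual n (?N + int m + 1) (T_sum (first_le n r (Suc ?k)))"
      unfolding first_le_step[OF less.prems(1) le_add1 Suc.prems[simplified]]
    proof (rule self_dual_diff)
      show "self_dual n (?N + int m + 1)
          (\<lambda>u. hecke_gen_mult n ?k (T_sum (first_le n r ?k)) u + T_sum (first_le n r ?k) u)"
        using less.prems Suc.prems by (intro self_dual_gen_mult 1) auto
      show "self_dual n (?N + int m + 1) (\<lambda>u. q_laurent * T_sum (first_le n r (?k - 1)) u)"
        using self_dual_shift[OF 2] by (simp add: algebra_simps)
    qed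
    then show ?case using 1 by (simp add: algebra_simps)
  qed
  from this[of "k - r"] show ?case using less.prems by simp
qed

section \<open>Sums over permutations with prescribed first and last entries\<close>

text \<open>The polynomials sought depend on \<open>x\<close> only through \<open>x 1\<close> and \<open>x n\<close>, and left multiplication by a generator
  changes these two values independently of all others.\<close>

definition ends :: "nat \<Rightarrow> (nat \<Rightarrow> nat \<Rightarrow> bool) \<Rightarrow> (nat \<Rightarrow> nat) set" where
  "ends n P = {x. x permutes {1..n} \<and> P (x 1) (x n)}"

text \<open>If \<open>x 1 = i\<close> then the value \<open>i\<close> stands before \<open>i + 1\<close>, and likewise if \<open>x n = i + 1\<close>; either way
  \<open>s\<^sub>i x\<close> is longer than \<open>x\<close>.\<close>

lemma gen_mult_ends:
  assumes i: "1 \<le> i" "i < n"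
    and disj: "\<And>a b. \<not> (P a b \<and> Q a b)"
    and stable: "\<And>a b. P a b \<Longrightarrow> P (simple_refl i a) (simple_refl i b)"
    and asc: "\<And>a b. Q a b \<Longrightarrow> a = i \<or> b = Suc i"
  shows "(\<lambda>u. hecke_gen_mult n i (T_sum (ends n (\<lambda>a b. P a b \<or> Q a b))) u
            + T_sum (ends n (\<lambda>a b. P a b \<or> Q a b)) u)
       = (\<lambda>u. (q_laurent + 1) * T_sum (ends n P) u + T_sum (ends n Q) u
            + T_sum (ends n (\<lambda>a b. Q (simple_refl i a) (simple_refl i b))) u)"
proof -
  have un: "ends n (\<lambda>a b. P a b \<or> Q a b) = ends n P \<union> ends n Q" by (auto simp: ends_def)
  have image: "{x. simple_refl i \<circ> x \<in> ends n Q} = ends n (\<lambda>a b. Q (simple_refl i a) (simple_refl i b))"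
    using i by (auto simp: ends_def)
  show ?thesis
    unfolding un image[symmetric]
  proof (rule gen_mult_T_sum[OF i])
    show "inv x i < inv x (Suc i)" if "x \<in> ends n Q" for x
    proof -
      have x: "x permutes {1..n}" and q: "x 1 = i \<or> x n = Suc i"
        using that asc by (auto simp: ends_def)
      have range: "inv x i \<in> {1..n}" "inv x (Suc i) \<in> {1..n}"
        using permutes_in_image[OF permutes_inv[OF x]] i by auto
      have "inv x i = 1 \<or> inv x (Suc i) = n"
        using q permutes_inverses(2)[OF x] by metis
      then show ?thesis using range inv_neq_Suc[OF x, of i] by auto
    qed
  qed (use disj stable i in \<open>auto simp: ends_def\<close>)
qed

lemma T_sum_ends_eq:
  assumes "x permutes {1..n}" 
  shows "T_sum (ends n P) x = (if P (x 1) (x n) then 1 else 0)"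
  using assms by (simp add: T_sum_def ends_def)

lemma hecke_eqI:
  assumes "\<And>x. x permutes {1..n} \<Longrightarrow> f x = (g x :: laurent)"
    and "f \<in> hecke_carrier n" "g \<in> hecke_carrier n"
  shows "f = g"
proof
  fix x show "f x = g x"
    using assms by (cases "x permutes {1..n}") (simp_all add: hecke_carrierD)
qed

lemma T_sum_ends_carrier: "T_sum (ends n P) \<in> hecke_carrier n"
  by (auto simp: hecke_carrier_def T_sum_def ends_def)

lemma ends_range:
  fixes x :: "nat \<Rightarrow> nat"
  assumes "x permutes {1..n}" "2 \<le> n"
  shows "1 \<le> x 1" "x 1 \<le> n" "1 \<le> x n" "x n \<le> n" "x 1 \<noteq> x n"
proof -
  show "1 \<le> x 1" "x 1 \<le> n" "1 \<le> x n" "x n \<le> n"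
    using permutes_in_image[OF assms(1), of 1] permutes_in_image[OF assms(1), of n] assms(2) by simp_all
  show "x 1 \<noteq> x n"
    using injD[OF permutes_inj[OF assms(1)], of 1 n] assms(2) by auto
qed

lemma first_le_1_eq_ends:
  assumes "k < n"
  shows "first_le n 1 k = ends n (\<lambda>a b. b = n \<and> a \<le> k)"
proof -
  have "x permutes {1..<n} \<longleftrightarrow> x permutes {1..n} \<and> x n = n" for x :: "nat \<Rightarrow> nat"
  proof
    assume x: "x permutes {1..<n}"
    have "x permutes {1..n}" by (rule permutes_subset[OF x]) auto
    then show "x permutes {1..n} \<and> x n = n"
      using permutes_not_in[OF x, of n] by simp
  next
    assume x: "x permutes {1..n} \<and> x n = n"
    show "x permutes {1..<n}"
    proof (rule permutes_superset)
      show "x permutes {1..n}" using x by simp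
      show "x y = y" if "y \<in> {1..n} - {1..<n}" for y
      proof -
        have "y = n" using that by auto
        with x show ?thesis by simp
      qed
    qed
  qed
  then show ?thesis unfolding first_le_def ends_def by blast
qed

abbreviation (input) first_sum :: "nat \<Rightarrow> nat \<Rightarrow> hecke" where
  "first_sum n k \<equiv> T_sum (ends n (\<lambda>a b. b = n \<and> a \<le> k))"

abbreviation (input) window_sum :: "nat \<Rightarrow> nat \<Rightarrow> hecke" where
  "window_sum n k \<equiv> T_sum (ends n (\<lambda>a b. a \<noteq> n \<and> k \<le> b))"

text \<open>For \<open>k = 2\<close> these coefficients are the polynomials to be found, at \<open>q\<close>: one wherever
  \<open>x 1 \<noteq> n\<close> and \<open>x n \<noteq> 1\<close>, plus a power of \<open>q\<close> where moreover \<open>x 1 = 1\<close> and \<open>x n = n\<close>. The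
  members with larger \<open>k\<close> lead there by a three-term recursion. The first of them,
  \<open>k = n - 1\<close>, is a sum of two self-dual elements, and this is how the correction term with
  \<open>first_sum\<close> enters.\<close>

definition KL_chain :: "nat \<Rightarrow> nat \<Rightarrow> hecke" where
  "KL_chain n k = (\<lambda>x. window_sum n k x + v_pow (2 * int (n - 1 - k)) * first_sum n (k - 1) x)"

lemma self_dual_first_sum:
  assumes "1 \<le> k" "k < n"
  shows "self_dual n (triangle (n - 2) + int k - 1) (first_sum n k)"
proof -
  have "triangle (n - 1 - 1) + int (k - 1) = triangle (n - 2) + int k - 1"
    using assms by (simp add: numeral_2_eq_2 One_nat_def)
  with self_dual_first_le[of 1 k n] assms show ?thesis
    by (simp only: first_le_1_eq_ends[OF assms(2)] le_refl)
qed

lemma simple_refl_if: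
  "simple_refl i a = (if a = i then Suc i else if a = Suc i then i else a)"
  by (simp add: simple_refl_def transpose_def)

lemma self_dual_second_top:
  assumes i: "2 \<le> i" and n: "n = Suc (Suc i)"
  shows "self_dual n (triangle i + int i) (T_sum (ends n (\<lambda>a b. Suc i \<le> b \<and> a \<le> i)))"
proof -
  have Si: "1 \<le> Suc i" "Suc i < n" using n by auto
  let ?s = "simple_refl (Suc i)"
  let ?Q = "\<lambda>a b. b = n \<and> a \<le> i"
  have eq: "(\<lambda>u. hecke_gen_mult n (Suc i) (first_sum n i) u + first_sum n i u)
      = (\<lambda>u. T_sum (ends n ?Q) u + T_sum (ends n (\<lambda>a b. ?Q (?s a) (?s b))) u)"
    using gen_mult_ends[OF Si, of "\<lambda>_ _. False" ?Q] n by (simp add: T_sum_def ends_def)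
  have "T_sum (ends n (\<lambda>a b. Suc i \<le> b \<and> a \<le> i)) =
    (\<lambda>u. hecke_gen_mult n (Suc i) (first_sum n i) u + first_sum n i u)"
    unfolding eq
  proof (rule hecke_eqI)
    fix x assume x: "x permutes {1..n}"
    have r: "1 \<le> x 1" "x 1 \<le> n" "1 \<le> x n" "x n \<le> n" "x 1 \<noteq> x n"
      using ends_range[OF x] i n by auto
    consider "x n = n" | "x n = Suc i" "x 1 = n" | "x n = Suc i" "x 1 \<le> i" | "x n \<le> i"
      using r n by linarith
    then show "T_sum (ends n (\<lambda>a b. Suc i \<le> b \<and> a \<le> i)) x = T_sum (ends n ?Q) x
          + T_sum (ends n (\<lambda>a b. ?Q (?s a) (?s b))) x"
      unfolding T_sum_ends_eq[OF x] simple_refl_if using r n by cases simp_all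
  qed (intro hecke_carrier_add T_sum_ends_carrier)+
  moreover have "self_dual n (triangle (n - 2) + int i - 1 + 1)
      (\<lambda>u. hecke_gen_mult n (Suc i) (first_sum n i) u + first_sum n i u)"
    using i n by (intro self_dual_gen_mult[OF Si] self_dual_first_sum) auto
  ultimately show ?thesis using n by simp
qed

text \<open>On either side the permutations counted twice are those with \<open>x n = n\<close> and \<open>x 1 \<le> n - 2\<close>.\<close>

lemma KL_chain_top:
  assumes i: "2 \<le> i" and n: "n = Suc (Suc i)"
  shows "KL_chain n (Suc i) =
    (\<lambda>x. first_sum n (Suc i) x + T_sum (ends n (\<lambda>a b. Suc i \<le> b \<and> a \<le> i)) x)"
  unfolding KL_chain_def
proof (rule hecke_eqI)
  fix x assume x: "x permutes {1..n}"
  have r: "1 \<le> x 1" "x 1 \<le> n" "1 \<le> x n" "x n \<le> n" "x 1 \<noteq> x n"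
    using ends_range[OF x] i n by auto
  consider "x n = n" "x 1 = Suc i" | "x n = n" "x 1 \<le> i" | "x n = Suc i" "x 1 = n"
    | "x n = Suc i" "x 1 \<le> i" | "x n \<le> i"
    using r n by linarith
  then show "window_sum n (Suc i) x + v_pow (2 * int (n - 1 - Suc i)) * first_sum n (Suc i - 1) x =
     first_sum n (Suc i) x + T_sum (ends n (\<lambda>a b. Suc i \<le> b \<and> a \<le> i)) x"
    unfolding T_sum_ends_eq[OF x] using r n by cases simp_all
qed (intro hecke_carrier_add hecke_carrier_scale T_sum_ends_carrier)+

text \<open>No correction is subtracted here: the term \<open>q\<close> times \<open>first_sum\<close> that arises is admissible for a
  Kazhdan--Lusztig element, and it is what grows to the power \<open>q\<^bsup>n - 3\<^esup>\<close> along the chain.\<close>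

lemma KL_chain_second:
  assumes i: "2 \<le> i" and n: "n = Suc (Suc i)"
  defines "V \<equiv> T_sum (ends n (\<lambda>a b. Suc i \<le> b \<and> a \<le> i))"
  shows "KL_chain n i = (\<lambda>u. hecke_gen_mult n i V u + V u)"
proof -
  let ?s = "simple_refl i"
  let ?P = "\<lambda>a b. b = n \<and> a < i"
  let ?Q = "\<lambda>a b. (b = n \<and> a = i) \<or> (b = Suc i \<and> a \<le> i)"
  have i': "1 \<le> i" "i < n" using i n by auto
  have V: "V = T_sum (ends n (\<lambda>a b. ?P a b \<or> ?Q a b))"
    unfolding V_def
  proof (rule hecke_eqI)
    fix x assume x: "x permutes {1..n}"
    have "Suc i \<le> x n \<and> x 1 \<le> i \<longleftrightarrow> ?P (x 1) (x n) \<or> ?Q (x 1) (x n)"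
      using ends_range[OF x] n by linarith
    then show "T_sum (ends n (\<lambda>a b. Suc i \<le> b \<and> a \<le> i)) x = T_sum (ends n (\<lambda>a b. ?P a b \<or> ?Q a b)) x"
      by (simp only: T_sum_ends_eq[OF x])
  qed (rule T_sum_ends_carrier)+
  have eq: "(\<lambda>u. hecke_gen_mult n i V u + V u) = (\<lambda>u. (q_laurent + 1) * T_sum (ends n ?P) u
      + T_sum (ends n ?Q) u + T_sum (ends n (\<lambda>a b. ?Q (?s a) (?s b))) u)"
    unfolding V
  proof (rule gen_mult_ends[OF i'])
    fix a b
    show "\<not> (?P a b \<and> ?Q a b)" using n by linarith
    show "?P (?s a) (?s b)" if "?P a b" using that n by (simp add: simple_refl_if)
    show "a = i \<or> b = Suc i" if "?Q a b" using that by linarith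
  qed
  show ?thesis
    unfolding eq KL_chain_def
  proof (rule hecke_eqI)
    fix x assume x: "x permutes {1..n}"
    have r: "1 \<le> x 1" "x 1 \<le> n" "1 \<le> x n" "x n \<le> n" "x 1 \<noteq> x n"
      using ends_range[OF x] i n by auto
    have le: "x 1 \<le> i - 1 \<longleftrightarrow> x 1 < i" using i by linarith
    have P: "T_sum (ends n ?P) x = (if x n = n \<and> x 1 < i then 1 else 0)"
      by (simp only: T_sum_ends_eq[OF x])
    have Q: "T_sum (ends n ?Q) x = (if x n = n \<and> x 1 = i \<or> x n = Suc i \<and> x 1 \<le> i then 1 else 0)"
      by (simp only: T_sum_ends_eq[OF x])
    have swap: "?s a = i \<longleftrightarrow> a = Suc i" "?s a = Suc i \<longleftrightarrow> a = i" "?s a = n \<longleftrightarrow> a = n"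
      "?s a \<le> i \<longleftrightarrow> a < i \<or> a = Suc i" for a
      using n by (cases "a = i"; cases "a = Suc i"; simp add: simple_refl_if le_less)+
    have "x 1 < i \<or> x 1 = Suc i \<longleftrightarrow> x 1 \<noteq> n" if "x n = i"
    proof -
      have "x 1 \<noteq> i" "x 1 \<le> Suc (Suc i)" using r that n by auto
      then show ?thesis unfolding n by linarith
    qed
    then have "?Q (?s (x 1)) (?s (x n)) \<longleftrightarrow> x n = n \<and> x 1 = Suc i \<or> x n = i \<and> x 1 \<noteq> n"
      unfolding swap by blast
    then have Q': "T_sum (ends n (\<lambda>a b. ?Q (?s a) (?s b))) x
        = (if x n = n \<and> x 1 = Suc i \<or> x n = i \<and> x 1 \<noteq> n then 1 else 0)"
      by (simp only: T_sum_ends_eq[OF x])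
    have W: "window_sum n i x = (if x 1 \<noteq> n \<and> i \<le> x n then 1 else 0)"
      by (simp only: T_sum_ends_eq[OF x])
    have U: "first_sum n (i - 1) x = (if x n = n \<and> x 1 < i then 1 else 0)"
      by (simp only: T_sum_ends_eq[OF x] le)
    have e: "2 * int (n - 1 - i) = 2" using n by simp
    consider "x n = n" "x 1 < i" | "x n = n" "x 1 = i" | "x n = n" "x 1 = Suc i"
      | "x n = Suc i" "x 1 \<le> i" | "x n = Suc i" "x 1 = n" | "x n = i" | "x n < i"
      using r n by linarith
    then show "window_sum n i x + v_pow (2 * int (n - 1 - i)) * first_sum n (i - 1) x =
      (q_laurent + 1) * T_sum (ends n ?P) x + T_sum (ends n ?Q) x
      + T_sum (ends n (\<lambda>a b. ?Q (?s a) (?s b))) x"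
      unfolding e P Q Q' W U using r n by cases simp_all
  qed (intro hecke_carrier_add hecke_carrier_scale T_sum_ends_carrier)+
qed

text \<open>With \<open>W\<close> for the window sums, \<open>U\<close> for the sums \<open>first_sum\<close> and \<open>b = T\<^sub>s\<^sub>i + 1\<close>, one has
  \<open>b W\<^sub>i\<^sub>+\<^sub>1 = W\<^sub>i + q W\<^sub>i\<^sub>+\<^sub>2\<close> and \<open>b U\<^sub>i = U\<^sub>i\<^sub>+\<^sub>1 + q U\<^sub>i\<^sub>-\<^sub>1\<close>. In the combination of both, the terms
  in \<open>W\<^sub>i\<^sub>+\<^sub>2\<close> and \<open>U\<^sub>i\<^sub>+\<^sub>1\<close> make up \<open>q\<close> times the chain element of index \<open>i + 2\<close>.\<close>

lemma KL_chain_step: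
  assumes k: "2 \<le> i" "i + 3 \<le> n"
  shows "KL_chain n i =
    (\<lambda>u. (hecke_gen_mult n i (KL_chain n (Suc i)) u + KL_chain n (Suc i) u)
       - q_laurent * KL_chain n (Suc (Suc i)) u)"
proof -
  let ?s = "simple_refl i"
  note s = simple_refl_if[of i]
  let ?c = "v_pow (2 * int (n - 1 - Suc i))"
  have i: "1 \<le> i" "i < n" using k by auto
  let ?P = "\<lambda>a b. a \<noteq> n \<and> Suc (Suc i) \<le> b" and ?Q = "\<lambda>a b. a \<noteq> n \<and> b = Suc i"
  let ?P' = "\<lambda>a b. b = n \<and> a < i" and ?Q' = "\<lambda>a b. b = n \<and> a = i"
  have "?P a b \<or> ?Q a b \<longleftrightarrow> a \<noteq> n \<and> Suc i \<le> b" for a b by linarith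
  then have W: "window_sum n (Suc i) = T_sum (ends n (\<lambda>a b. ?P a b \<or> ?Q a b))" by simp
  have "?P' a b \<or> ?Q' a b \<longleftrightarrow> b = n \<and> a \<le> i" for a b by linarith
  then have U: "first_sum n i = T_sum (ends n (\<lambda>a b. ?P' a b \<or> ?Q' a b))" by simp
  have eqW: "(\<lambda>u. hecke_gen_mult n i (window_sum n (Suc i)) u + window_sum n (Suc i) u)
     = (\<lambda>u. (q_laurent + 1) * T_sum (ends n ?P) u + T_sum (ends n ?Q) u
          + T_sum (ends n (\<lambda>a b. ?Q (?s a) (?s b))) u)"
    unfolding W
    by (rule gen_mult_ends[OF i]) (use k in \<open>simp_all add: s\<close>)
  have eqU: "(\<lambda>u. hecke_gen_mult n i (first_sum n i) u + first_sum n i u)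
     = (\<lambda>u. (q_laurent + 1) * T_sum (ends n ?P') u + T_sum (ends n ?Q') u
          + T_sum (ends n (\<lambda>a b. ?Q' (?s a) (?s b))) u)"
    unfolding U
    by (rule gen_mult_ends[OF i]) (use k in \<open>simp_all add: s\<close>)
  have "(\<lambda>u. hecke_gen_mult n i (KL_chain n (Suc i)) u + KL_chain n (Suc i) u)
     = (\<lambda>u. (hecke_gen_mult n i (window_sum n (Suc i)) u + window_sum n (Suc i) u)
          + ?c * (hecke_gen_mult n i (first_sum n i) u + first_sum n i u))"
    unfolding KL_chain_def hecke_gen_mult_add[OF i] hecke_gen_mult_scale[OF i] diff_Suc_1
    by (simp add: distrib_left add_ac)
  also have "\<dots> = (\<lambda>u. ((q_laurent + 1) * T_sum (ends n ?P) u + T_sum (ends n ?Q) u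
          + T_sum (ends n (\<lambda>a b. ?Q (?s a) (?s b))) u)
      + ?c * ((q_laurent + 1) * T_sum (ends n ?P') u + T_sum (ends n ?Q') u
          + T_sum (ends n (\<lambda>a b. ?Q' (?s a) (?s b))) u))"
    by (simp only: fun_cong[OF eqW] fun_cong[OF eqU])
  finally have eq: "(\<lambda>u. hecke_gen_mult n i (KL_chain n (Suc i)) u + KL_chain n (Suc i) u) = \<dots>" .
  have c1: "v_pow (2 * int (n - 1 - i)) = q_laurent * ?c"
  proof -
    have "2 + 2 * int (n - 1 - Suc i) = 2 * int (n - 1 - i)" using k by simp
    then show ?thesis by (simp only: v_pow_mult_v_pow)
  qed
  have c2: "q_laurent * (w + v_pow (2 * int (n - 1 - Suc (Suc i))) * f) = q_laurent * w + ?c * f" for w f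
  proof -
    have "2 + 2 * int (n - 1 - Suc (Suc i)) = 2 * int (n - 1 - Suc i)" using k by simp
    then show ?thesis by (simp only: distrib_left v_pow_mult_assoc)
  qed
  show ?thesis
  proof (rule hecke_eqI)
    fix x assume x: "x permutes {1..n}"
    have r: "1 \<le> x 1" "x 1 \<le> n" "1 \<le> x n" "x n \<le> n" "x 1 \<noteq> x n"
      using ends_range[OF x] k by auto
    have w: "(q_laurent + 1) * T_sum (ends n ?P) x + T_sum (ends n ?Q) x
          + T_sum (ends n (\<lambda>a b. ?Q (?s a) (?s b))) x
        = window_sum n i x + q_laurent * window_sum n (Suc (Suc i)) x"
    proof -
      consider "x n < i" | "x n = i" | "x n = Suc i" | "Suc (Suc i) \<le> x n" by linarith
      then show ?thesis
        using r k by cases (simp_all add: T_sum_ends_eq[OF x] s)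
    qed
    have u: "(q_laurent + 1) * T_sum (ends n ?P') x + T_sum (ends n ?Q') x
          + T_sum (ends n (\<lambda>a b. ?Q' (?s a) (?s b))) x
        = first_sum n (Suc i) x + q_laurent * first_sum n (i - 1) x"
    proof -
      have le: "x 1 \<le> i - 1 \<longleftrightarrow> x 1 < i" using k by linarith
      consider "x 1 < i" | "x 1 = i" | "x 1 = Suc i" | "Suc (Suc i) \<le> x 1" by linarith
      then show ?thesis
        unfolding T_sum_ends_eq[OF x] le s using r k by cases simp_all
    qed
    have "hecke_gen_mult n i (KL_chain n (Suc i)) x + KL_chain n (Suc i) x
      = (window_sum n i x + q_laurent * window_sum n (Suc (Suc i)) x)
        + ?c * (first_sum n (Suc i) x + q_laurent * first_sum n (i - 1) x)"
      using fun_cong[OF eq, of x] unfolding w u .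
    then show "KL_chain n i x = hecke_gen_mult n i (KL_chain n (Suc i)) x + KL_chain n (Suc i) x
        - q_laurent * KL_chain n (Suc (Suc i)) x"
      by (simp only: KL_chain_def c1 c2 diff_Suc_1) (simp add: algebra_simps)
  next
    have "KL_chain n j \<in> hecke_carrier n" for j
      unfolding KL_chain_def by (intro hecke_carrier_add hecke_carrier_scale T_sum_ends_carrier)
    note C = this
    show "KL_chain n i \<in> hecke_carrier n" by (rule C)
    show "(\<lambda>u. hecke_gen_mult n i (KL_chain n (Suc i)) u + KL_chain n (Suc i) u
        - q_laurent * KL_chain n (Suc (Suc i)) u) \<in> hecke_carrier n"
      by (intro hecke_carrier_diff hecke_carrier_add hecke_carrier_scale hecke_gen_mult_carrier[OF i] C)
  qed
qed

text \<open>The recursion runs downwards from the indices \<open>n - 1\<close> and \<open>n - 2\<close>.\<close>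

lemma self_dual_KL_chain:
  assumes n: "4 \<le> n" and k: "2 \<le> k" "k < n"
  shows "self_dual n (triangle (n - 2) + 2 * int n - 3 - int k) (KL_chain n k)"
proof -
  let ?N = "\<lambda>k. triangle (n - 2) + 2 * int n - 3 - int k"
  obtain i where i: "2 \<le> i" and ni: "n = Suc (Suc i)"
    using n that[of "n - 2"] by simp
  note V = self_dual_second_top[OF i ni]
  have e: "n - 2 = i" "n - 1 = Suc i" using ni by auto
  have top: "self_dual n (?N (n - 1)) (KL_chain n (n - 1))"
  proof -
    have "self_dual n (triangle (n - 2) + int (Suc i) - 1) (first_sum n (Suc i))"
      by (rule self_dual_first_sum) (use ni in auto)
    moreover have "triangle (n - 2) + int (Suc i) - 1 = triangle i + int i"
      "?N (n - 1) = triangle i + int i" using ni by auto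
    ultimately show ?thesis
      unfolding e KL_chain_top[OF i ni] by (simp only: self_dual_add[OF _ V])
  qed
  have second: "self_dual n (?N (n - 2)) (KL_chain n (n - 2))"
  proof -
    have "?N i = triangle i + int i + 1" using ni e by simp
    moreover have "self_dual n (triangle i + int i + 1) (KL_chain n i)"
      unfolding KL_chain_second[OF i ni] by (rule self_dual_gen_mult[OF _ _ V]) (use i ni in auto)
    ultimately show ?thesis unfolding e by (simp only: e)
  qed
  have "self_dual n (?N (n - 2 - m)) (KL_chain n (n - 2 - m)) \<and>
      self_dual n (?N (n - 1 - m)) (KL_chain n (n - 1 - m))" if "m + 4 \<le> n" for m
    using that
  proof (induction m)
    case 0
    then show ?case using top second by simp
  next
    case (Suc m)
    let ?i = "n - 3 - m"
    have i: "2 \<le> ?i" "?i + 3 \<le> n" using Suc.prems by auto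
    have e: "n - 1 - m = Suc (Suc ?i)" "n - 2 - m = Suc ?i" "n - 2 - Suc m = ?i" "n - 1 - Suc m = Suc ?i"
      using Suc.prems by auto
    have 1: "self_dual n (?N (Suc ?i)) (KL_chain n (Suc ?i))"
      and 2: "self_dual n (?N (Suc (Suc ?i))) (KL_chain n (Suc (Suc ?i)))"
      using Suc unfolding e by auto
    have N: "?N ?i = ?N (Suc ?i) + 1" "?N ?i = ?N (Suc (Suc ?i)) + 2" by auto
    have "self_dual n (?N ?i) (KL_chain n ?i)"
      unfolding KL_chain_step[OF i]
    proof (rule self_dual_diff)
      show "self_dual n (?N ?i) (\<lambda>u. hecke_gen_mult n ?i (KL_chain n (Suc ?i)) u + KL_chain n (Suc ?i) u)"
        unfolding N(1) using i by (intro self_dual_gen_mult 1) auto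
      show "self_dual n (?N ?i) (\<lambda>u. q_laurent * KL_chain n (Suc (Suc ?i)) u)"
        unfolding N(2) by (rule self_dual_shift[OF 2])
    qed
    then show ?case using 1 unfolding e by simp
  qed
  note all = this
  show ?thesis
  proof (cases "k = n - 1")
    case True
    then show ?thesis using top by simp
  next
    case False
    then have "n - 2 - (n - 2 - k) = k" "n - 2 - k + 4 \<le> n" using k by auto
    then show ?thesis using all[of "n - 2 - k"] by metis
  qed
qed

section \<open>Bruhat order\<close>

text \<open>The inversions of \<open>x\<close> inject into those of \<open>x t\<close>, where \<open>t\<close> is the transposition: move a pair of
  positions by \<open>t\<close> if this preserves the order of the pair, and keep it otherwise. A pair that is kept
  is \<open>(a, d)\<close> or \<open>(d, b)\<close> with \<open>d\<close> between \<open>a\<close> and \<open>b\<close>. The new inversion \<open>(a, b)\<close> is not in the image.\<close>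

lemma card_inversions_transpose:
  assumes x: "x permutes {1..n}" and a: "a \<in> {1..n}" and b: "b \<in> {1..n}" and ab: "a < b" "x a < x b"
  shows "card (inversions n x) < card (inversions n (x \<circ> transpose a b))"
proof -
  let ?t = "transpose a b"
  define f where "f = (\<lambda>(c, d). if ?t c < ?t d then (?t c, ?t d) else (c, d))"
  have tr: "?t c = (if c = a then b else if c = b then a else c)" for c
    by (simp add: transpose_def)
  have range: "?t c \<in> {1..n} \<longleftrightarrow> c \<in> {1..n}" for c using a b by (simp add: tr)
  have inv: "(c, d) \<in> inversions n x \<longleftrightarrow> c \<in> {1..n} \<and> d \<in> {1..n} \<and> c < d \<and> x d < x c" for c d
    by (simp add: inversions_def)
  have flip: "(c = a \<and> a < d \<and> d < b) \<or> (d = b \<and> a < c \<and> c < b)"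
    if "(c, d) \<in> inversions n x" "\<not> ?t c < ?t d" for c d
  proof -
    have cd: "c < d" "x d < x c" using that(1) by (auto simp: inv)
    consider "c = a" | "c = b" | "c \<noteq> a" "c \<noteq> b" by blast
    then show ?thesis
      using that(2) cd ab unfolding tr by cases (simp_all split: if_split_asm)
  qed
  have maps: "f p \<in> inversions n (x \<circ> ?t) - {(a, b)}" if "p \<in> inversions n x" for p
  proof -
    obtain c d where p: "p = (c, d)" by fastforce
    have cd: "c \<in> {1..n}" "d \<in> {1..n}" "c < d" "x d < x c" using that unfolding p inv by auto
    show ?thesis
    proof (cases "?t c < ?t d")
      case True
      have "?t c \<noteq> a \<or> ?t d \<noteq> b"
      proof (rule ccontr)
        assume "\<not> ?thesis"
        then have "c = ?t a" "d = ?t b" by (metis transpose_involutory)+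
        then have "c = b" "d = a" by simp_all
        then show False using cd(3) ab(1) by simp
      qed
      moreover have "?t c \<in> {1..n}" "?t d \<in> {1..n}" using cd(1,2) range by blast+
      ultimately show ?thesis
        using True cd(4) by (simp add: p f_def inversions_def)
    next
      case False
      from flip[OF that[unfolded p] this] show ?thesis
      proof
        assume "c = a \<and> a < d \<and> d < b"
        then show ?thesis using False cd ab by (simp add: p f_def inversions_def tr)
      next
        assume "d = b \<and> a < c \<and> c < b"
        then show ?thesis using False cd ab by (simp add: p f_def inversions_def tr)
      qed
    qed
  qed
  have "inj_on f (inversions n x)"
  proof (rule inj_onI)
    \<comment> \<open>A moved pair is not also a kept one: moving a kept pair reverses it, moving back a moved one does not.\<close>
    have mixed: "(?t c, ?t d) \<noteq> (c', d')"
      if "(c, d) \<in> inversions n x" "(c', d') \<in> inversions n x" "\<not> ?t c' < ?t d'" for c d c' d'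
    proof
      assume "(?t c, ?t d) = (c', d')"
      then have "c = ?t c'" "d = ?t d'" by auto
      then show False using that by (simp add: inv)
    qed
    fix p p' assume pp: "p \<in> inversions n x" "p' \<in> inversions n x" "f p = f p'"
    obtain c d c' d' where p: "p = (c, d)" "p' = (c', d')" by fastforce
    show "p = p'"
    proof (cases "?t c < ?t d"; cases "?t c' < ?t d'")
      assume "?t c < ?t d" "?t c' < ?t d'"
      then have "?t c = ?t c'" "?t d = ?t d'" using pp(3) by (auto simp: p f_def)
      then show ?thesis unfolding p by (metis transpose_involutory)
    next
      assume "?t c < ?t d" "\<not> ?t c' < ?t d'"
      moreover from this have "(?t c, ?t d) = (c', d')" using pp(3) by (simp add: p f_def)
      ultimately show ?thesis using mixed[of c d c' d'] pp(1,2) unfolding p by blast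
    next
      assume "\<not> ?t c < ?t d" "?t c' < ?t d'"
      moreover from this have "(?t c', ?t d') = (c, d)" using pp(3) by (simp add: p f_def)
      ultimately show ?thesis using mixed[of c' d' c d] pp(1,2) unfolding p by blast
    next
      assume "\<not> ?t c < ?t d" "\<not> ?t c' < ?t d'"
      then show ?thesis using pp(3) by (simp add: p f_def)
    qed
  qed
  then have "card (inversions n x) \<le> card (inversions n (x \<circ> ?t) - {(a, b)})"
  proof (rule card_inj_on_le)
    show "f ` inversions n x \<subseteq> inversions n (x \<circ> ?t) - {(a, b)}"
      by (intro image_subsetI maps)
  next
    show "finite (inversions n (x \<circ> ?t) - {(a, b)})" by simp
  qed
  moreover have "(a, b) \<in> inversions n (x \<circ> ?t)" using a b ab by (simp add: inversions_def)
  then have "card (inversions n (x \<circ> ?t) - {(a, b)}) < card (inversions n (x \<circ> ?t))"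
    by (intro psubset_card_mono) auto
  ultimately show ?thesis by linarith
qed

lemma bruhat_le_transpose:
  assumes x: "x permutes {1..n}" and a: "a \<in> {1..n}" and b: "b \<in> {1..n}" and ab: "a < b" "x a < x b"
    and le: "bruhat_le n (x \<circ> transpose a b) w"
  shows "bruhat_le n x w"
proof -
  have y: "x \<circ> transpose a b permutes {1..n}" using le by (simp add: bruhat_le_def)
  have "coxeter_length n x < coxeter_length n (x \<circ> transpose a b)"
    using card_inversions_transpose[OF assms(1-5)] by (simp only: coxeter_length_eq[OF x] coxeter_length_eq[OF y])
  then have "bruhat_step n x (x \<circ> transpose a b)"
    unfolding bruhat_step_def using a b ab by (intro conjI bexI[of _ a] bexI[of _ b]) auto
  then show ?thesis
    using le x unfolding bruhat_le_def by (meson converse_rtranclp_into_rtranclp)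
qed

lemma bruhat_le_length:
  assumes "bruhat_le n x w" "x \<noteq> w"
  shows "coxeter_length n x < coxeter_length n w"
proof -
  have "(bruhat_step n)\<^sup>*\<^sup>* u v \<Longrightarrow> u = v \<or> coxeter_length n u < coxeter_length n v" for u v
    by (induction rule: rtranclp_induct) (auto simp: bruhat_step_def)
  then show ?thesis using assms by (auto simp: bruhat_le_def)
qed

text \<open>The permutation \<open>x \<circ> inv w\<close> has no descents.\<close>

lemma permutes_eq_if_same_order:
  fixes x w :: "nat \<Rightarrow> nat"
  assumes x: "x permutes {1..n}" and w: "w permutes {1..n}"
    and order: "\<And>a b. a \<in> {1..n} \<Longrightarrow> b \<in> {1..n} \<Longrightarrow> w a < w b \<Longrightarrow> x a < x b"
  shows "x = w"
proof -
  have "x \<circ> inv w = id"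
  proof (rule permutes_no_descent_id[of _ n])
    show "x \<circ> inv w permutes {1..n}" by (rule permutes_compose[OF permutes_inv[OF w] x])
    fix i assume i: "1 \<le> i" "i < n"
    have "inv w i \<in> {1..n}" "inv w (Suc i) \<in> {1..n}"
      using permutes_in_image[OF permutes_inv[OF w]] i by simp_all
    moreover have "w (inv w i) < w (inv w (Suc i))" by (simp add: permutes_inverses(1)[OF w])
    ultimately have "x (inv w i) < x (inv w (Suc i))" by (rule order)
    then show "\<not> (x \<circ> inv w) (Suc i) < (x \<circ> inv w) i" by simp
  qed
  then have "x \<circ> inv w \<circ> w = w" by simp
  then show ?thesis by (simp add: comp_assoc permutes_inv_o(2)[OF w])
qed

text \<open>The reversal of \<open>{1..n}\<close> with the entries at the positions \<open>1, 2\<close> exchanged and those at \<open>n - 1, n\<close>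
  exchanged, described by the pairs of positions in increasing order. For \<open>n = l + 2\<close> with \<open>l \<ge> 2\<close> it is \<open>w_perm l\<close>;
  the description gives its length at once and is what a maximality argument yields.\<close>

definition is_top :: "nat \<Rightarrow> (nat \<Rightarrow> nat) \<Rightarrow> bool" where
  "is_top n w \<longleftrightarrow> w permutes {1..n} \<and>
     (\<forall>a\<in>{1..n}. \<forall>b\<in>{1..n}. a < b \<longrightarrow> (w a < w b \<longleftrightarrow> (a = 1 \<and> b = 2) \<or> (Suc a = n \<and> b = n)))"

lemma is_topD:
  assumes "is_top n w" "a \<in> {1..n}" "b \<in> {1..n}" "a < b"
  shows "w a < w b \<longleftrightarrow> (a = 1 \<and> b = 2) \<or> (Suc a = n \<and> b = n)"
  using assms by (simp add: is_top_def)

text \<open>The hypothesis says that no transposition lengthens \<open>x\<close> without putting \<open>n\<close> at the first or \<open>1\<close> at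
  the last position. The increasing pairs of \<open>x\<close> are then among \<open>(1, q)\<close> and \<open>(p, n)\<close>, where \<open>q\<close> and \<open>p\<close>
  are the positions of \<open>n\<close> and \<open>1\<close>. Testing \<open>(2, q)\<close> and \<open>(p, n - 1)\<close> forces \<open>q = 2\<close> and
  \<open>p = n - 1\<close>, so \<open>x\<close> has the same increasing pairs as \<open>w\<close>.\<close>

lemma bruhat_maximal_eq_top:
  assumes n: "4 \<le> n" and w: "is_top n w" and x: "x permutes {1..n}" and ends: "x 1 \<noteq> n" "x n \<noteq> 1"
    and maximal: "\<And>a b. a \<in> {1..n} \<Longrightarrow> b \<in> {1..n} \<Longrightarrow> a < b \<Longrightarrow> x a < x b \<Longrightarrow>
      (a = 1 \<and> x b = n) \<or> (b = n \<and> x a = 1)"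
  shows "x = w"
proof -
  have wp: "w permutes {1..n}" using w by (simp add: is_top_def)
  have inj: "x a = x b \<longleftrightarrow> a = b" for a b using permutes_inj[OF x] by (auto dest: injD)
  have rng: "1 \<le> x a" "x a \<le> n" if "1 \<le> a" "a \<le> n" for a
    using permutes_in_image[OF x, of a] that by auto
  define q p where "q = inv x n" and "p = inv x 1"
  have q: "x q = n" and p: "x p = 1" unfolding q_def p_def by (rule permutes_inverses(1)[OF x])+
  have "q \<in> {1..n}" "p \<in> {1..n}" using permutes_in_image[OF x, of q] permutes_in_image[OF x, of p] p q n by auto
  then have qp: "1 \<le> q" "q \<le> n" "1 \<le> p" "p \<le> n" by auto
  have ne: "q \<noteq> 1" "p \<noteq> n" using ends q p by auto
  have lt_n: "x a < n" if "1 \<le> a" "a \<le> n" "a \<noteq> q" for a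
    using rng[OF that(1,2)] inj[of a q] q that(3) by (simp add: le_less)
  have gt_1: "1 < x a" if "1 \<le> a" "a \<le> n" "a \<noteq> p" for a
    using rng[OF that(1,2)] inj[of a p] p that(3) by (simp add: le_less)
  have q2: "q = 2"
  proof (rule ccontr)
    assume "q \<noteq> 2"
    then have "q > 2" using qp ne by simp
    then have "x 2 < x q" using lt_n[of 2] q qp by simp
    then have "q = n" "x 2 = 1" using maximal[of 2 q] \<open>q > 2\<close> qp by auto
    then have "p = 2" using inj[of p 2] p by simp
    have "x 3 < n" using lt_n[of 3] n \<open>q = n\<close> by simp
    then have "x 3 = 1" using maximal[of 3 n] n q \<open>q = n\<close> by simp
    then show False using inj[of 2 3] \<open>x 2 = 1\<close> by simp
  qed
  have p1: "Suc p = n"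
  proof (rule ccontr)
    assume "Suc p \<noteq> n"
    then have "p < n - 1" using qp ne by linarith
    then have "x p < x (n - 1)" using gt_1[of "n - 1"] p n by simp
    then have "x (n - 1) = n" using maximal[of p "n - 1"] \<open>p < n - 1\<close> qp n by auto
    then have "n - 1 = 2" using inj[of "n - 1" q] q q2 by simp
    then show False using n by simp
  qed
  show ?thesis
  proof (rule permutes_eq_if_same_order[OF x wp])
    fix a b assume a: "a \<in> {1..n}" and b: "b \<in> {1..n}" and wab: "w a < w b"
    consider "a < b" | "b < a" using wab by (cases a b rule: linorder_cases) auto
    then show "x a < x b"
    proof cases
      case 1
      then have "(a = 1 \<and> b = 2) \<or> (Suc a = n \<and> b = n)" using is_topD[OF w a b] wab by simp
      then show ?thesis
      proof
        assume "a = 1 \<and> b = 2"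
        then show ?thesis using lt_n[of 1] q q2 n by simp
      next
        assume h: "Suc a = n \<and> b = n"
        then have "a = p" using p1 by simp
        then show ?thesis using gt_1[of n] p h ne n by simp
      qed
    next
      case 2
      have not: "\<not> ((b = 1 \<and> a = 2) \<or> (Suc b = n \<and> a = n))"
        using is_topD[OF w b a 2] wab by simp
      have "\<not> x b < x a"
      proof
        assume "x b < x a"
        from maximal[OF b a 2 this] show False
          using not q2 p1 q p inj by metis
      qed
      then show ?thesis using inj[of a b] 2 by (simp add: not_less le_less)
    qed
  qed
qed

text \<open>Lengthen \<open>x\<close> by transpositions within the set described by the two conditions until this is no longer
  possible.\<close>

lemma bruhat_le_top:
  assumes n: "4 \<le> n" and w: "is_top n w"
  shows "x permutes {1..n} \<Longrightarrow> x 1 \<noteq> n \<Longrightarrow> x n \<noteq> 1 \<Longrightarrow> bruhat_le n x w"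
\<comment> \<open>Inversions are pairs of positions, so there are at most \<open>n * n\<close> of them.\<close>
proof (induction "n * n - card (inversions n x)" arbitrary: x rule: less_induct)
  case less
  note x = less.prems(1)
  show ?case
  proof (cases "x = w")
    case True
    then show ?thesis using x by (simp add: bruhat_le_def)
  next
    case False
    then obtain a b where a: "a \<in> {1..n}" and b: "b \<in> {1..n}" and ab: "a < b" "x a < x b"
      and ok: "\<not> ((a = 1 \<and> x b = n) \<or> (b = n \<and> x a = 1))"
      using bruhat_maximal_eq_top[OF n w less.prems] by blast
    let ?y = "x \<circ> transpose a b"
    have y: "?y permutes {1..n}" by (rule permutes_compose[OF permutes_swap_id[OF a b] x])
    have "?y 1 \<noteq> n" using ok less.prems(2) a ab b by (auto simp: transpose_def)
    moreover have "?y n \<noteq> 1" using ok less.prems(3) a ab b by (auto simp: transpose_def)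
    moreover have "card (inversions n ?y) \<le> n * n"
    proof -
      have "card (inversions n ?y) \<le> card ({1..n} \<times> {1..n})"
        by (rule card_mono) (auto simp: inversions_def)
      then show ?thesis by simp
    qed
    then have "n * n - card (inversions n ?y) < n * n - card (inversions n x)"
      using card_inversions_transpose[OF x a b ab] by linarith
    ultimately have "bruhat_le n ?y w" using less.hyps y by blast
    then show ?thesis by (rule bruhat_le_transpose[OF x a b ab])
  qed
qed

section \<open>Lengths\<close>

lemma card_increasing_pairs:
  "int (card {(a, b). a \<in> {r..<r + m} \<and> b \<in> {r..<r + m} \<and> a < b}) = triangle m"
proof (induction m)
  case (Suc m)
  let ?S = "\<lambda>m. {(a, b). a \<in> {r..<r + m} \<and> b \<in> {r..<r + m} \<and> a < b}"
  have fin: "finite (?S m)" by (rule finite_subset[of _ "{r..<r + m} \<times> {r..<r + m}"]) auto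
  have "?S (Suc m) = ?S m \<union> {r..<r + m} \<times> {r + m}" by auto
  moreover have "card (?S m \<union> {r..<r + m} \<times> {r + m}) = card (?S m) + card ({r..<r + m} \<times> {r + m})"
    using fin by (intro card_Un_disjoint) auto
  ultimately show ?case using Suc by (simp add: card_cartesian_product)
qed simp

text \<open>All pairs of positions are inversions except \<open>(1, 2)\<close> and \<open>(n - 1, n)\<close>.\<close>

lemma coxeter_length_top:
  assumes n: "4 \<le> n" and w: "is_top n w"
  shows "int (coxeter_length n w) = triangle n - 2"
proof -
  let ?S = "{(a, b). a \<in> {1..<1 + n} \<and> b \<in> {1..<1 + n} \<and> a < b}"
  have wp: "w permutes {1..n}" using w by (simp add: is_top_def)
  have inj: "w a = w b \<longleftrightarrow> a = b" for a b using permutes_inj[OF wp] by (auto dest: injD)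
  have "(a, b) \<in> inversions n w \<longleftrightarrow> (a, b) \<in> ?S - {(1, 2), (n - 1, n)}" for a b
  proof (cases "a \<in> {1..n} \<and> b \<in> {1..n} \<and> a < b")
    case True
    then have "w b < w a \<longleftrightarrow> \<not> w a < w b" using inj[of a b] by auto
    then show ?thesis using is_topD[OF w, of a b] True by (auto simp: inversions_def)
  qed (auto simp: inversions_def)
  then have eq: "inversions n w = ?S - {(1, 2), (n - 1, n)}" by auto
  have "card (?S - {(1, 2), (n - 1, n)}) = card ?S - card {(1::nat, 2::nat), (n - 1, n)}"
    by (rule card_Diff_subset) (use n in auto)
  moreover have "card {(1::nat, 2::nat), (n - 1, n)} = 2" using n by auto
  moreover have "2 \<le> card ?S"
  proof -
    have "finite ?S" by (rule finite_subset[of _ "{1..n} \<times> {1..n}"]) auto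
    then have "card {(1::nat, 2::nat), (n - 1, n)} \<le> card ?S" by (rule card_mono) (use n in auto)
    then show ?thesis using \<open>card {(1::nat, 2::nat), (n - 1, n)} = 2\<close> by simp
  qed
  ultimately show ?thesis
    using card_increasing_pairs[of 1 n] unfolding coxeter_length_eq[OF wp] eq by linarith
qed

text \<open>The positions \<open>1\<close> and \<open>n\<close> take part in no inversion.\<close>

lemma coxeter_length_fixed_ends:
  assumes n: "4 \<le> n" and x: "x permutes {1..n}" and fixed: "x 1 = 1" "x n = n"
  shows "int (coxeter_length n x) \<le> triangle (n - 2)"
proof -
  let ?S = "{(a, b). a \<in> {2..<2 + (n - 2)} \<and> b \<in> {2..<2 + (n - 2)} \<and> a < b}"
  have rng: "x a \<in> {1..n}" if "a \<in> {1..n}" for a using permutes_in_image[OF x] that by blast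
  have "inversions n x \<subseteq> ?S"
  proof
    fix p assume p: "p \<in> inversions n x"
    obtain a b where ab: "p = (a, b)" by fastforce
    have h: "a \<in> {1..n}" "b \<in> {1..n}" "a < b" "x b < x a" using p by (auto simp: ab inversions_def)
    have "a \<noteq> 1" using rng[OF h(2)] h(4) fixed by auto
    moreover have "b \<noteq> n" using rng[OF h(1)] h(4) fixed by auto
    ultimately show "p \<in> ?S" using h n by (auto simp: ab)
  qed
  moreover have "finite ?S" by (rule finite_subset[of _ "{2..<2 + (n - 2)} \<times> {2..<2 + (n - 2)}"]) auto
  ultimately have "card (inversions n x) \<le> card ?S" by (intro card_mono)
  then show ?thesis using card_increasing_pairs[of 2 "n - 2"] by (simp only: coxeter_length_eq[OF x])
qed

section \<open>The Kazhdan--Lusztig polynomials below the top permutation\<close>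

definition KL_family :: "nat \<Rightarrow> (nat \<Rightarrow> nat) \<Rightarrow> int poly" where
  "KL_family n x =
     (if x permutes {1..n} \<and> x 1 \<noteq> n \<and> x n \<noteq> 1
      then (if x 1 = 1 \<and> x n = n then 1 + monom 1 (n - 3) else 1) else 0)"

lemma eval_at_q_1: "eval_at_q 1 = 1"
  by (simp add: eval_at_q_def)

lemma eval_at_q_1_monom: "eval_at_q (1 + monom 1 d) = 1 + v_pow (2 * int d)"
proof (rule poly_mapping_eqI)
  fix m
  show "Poly_Mapping.lookup (eval_at_q (1 + monom 1 d)) m = Poly_Mapping.lookup (1 + v_pow (2 * int d)) m"
  proof (cases "even m \<and> 0 \<le> m")
    case True
    then have "m = 2 * int (nat (m div 2))" by simp
    then obtain j where "m = 2 * int j" ..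
    then show ?thesis
      by (auto simp: lookup_eval_at_q lookup_add lookup_v_pow lookup_one when_def coeff_monom coeff_1)
  next
    case False
    then have "m \<noteq> 2 * int d" "m \<noteq> 0" by auto
    with False show ?thesis
      by (simp add: lookup_eval_at_q lookup_add lookup_v_pow lookup_one)
  qed
qed

text \<open>Invariance under the bar involution is self-duality of the chain element of index \<open>2\<close>, whose exponent
  is the length of \<open>w\<close>. The degree bound is sharp at the longest \<open>x\<close> that fixes \<open>1\<close> and \<open>n\<close>,
  which is shorter than \<open>w\<close> by \<open>2 * (n - 3) + 1\<close>.\<close>

lemma is_KL_family_KL_family:
  assumes n: "4 \<le> n" and w: "is_top n w" and w1: "w 1 \<noteq> 1"  "w 1 \<noteq> n" "w n \<noteq> 1"
  shows "is_KL_family n w (KL_family n)"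
  unfolding is_KL_family_def
proof (intro conjI allI impI)
  have wp: "w permutes {1..n}" using w by (simp add: is_top_def)
  show "KL_family n w = 1" using wp w1 by (simp add: KL_family_def)
  show "KL_family n x = 0" if "\<not> bruhat_le n x w" for x
    using that bruhat_le_top[OF n w] by (auto simp: KL_family_def)
  have len: "int (coxeter_length n w) = triangle n - 2" by (rule coxeter_length_top[OF n w])
  have tri: "triangle n = triangle (n - 2) + 2 * int n - 3"
  proof -
    obtain m where "n = Suc (Suc m)" using n that[of "n - 2"] by simp
    then show ?thesis by simp
  qed
  show "real (degree (KL_family n x)) \<le> (real (coxeter_length n w) - real (coxeter_length n x) - 1) / 2"
    if "bruhat_le n x w \<and> x \<noteq> w" for x
  proof (cases "x permutes {1..n} \<and> x 1 = 1 \<and> x n = n")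
    case True
    then have "int (coxeter_length n x) \<le> triangle (n - 2)"
      using coxeter_length_fixed_ends[OF n] by blast
    then have "int (coxeter_length n x) + 2 * int n - 5 \<le> int (coxeter_length n w)"
      using len tri by linarith
    moreover have "degree (1 + monom (1::int) (n - 3)) \<le> n - 3"
      by (rule degree_add_le) (simp_all add: degree_monom_le)
    then have "degree (KL_family n x) \<le> n - 3" by (simp add: KL_family_def)
    ultimately have "2 * int (degree (KL_family n x)) + int (coxeter_length n x) + 1 \<le> int (coxeter_length n w)"
      using n by linarith
    then have "2 * degree (KL_family n x) + coxeter_length n x + 1 \<le> coxeter_length n w" by linarith
    then have "real (2 * degree (KL_family n x) + coxeter_length n x + 1) \<le> real (coxeter_length n w)"
      by (simp only: of_nat_le_iff)
    then show ?thesis by simp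
  next
    case False
    then have "degree (KL_family n x) = 0" by (auto simp: KL_family_def)
    moreover have "coxeter_length n x < coxeter_length n w" using bruhat_le_length that by blast
    ultimately show ?thesis by simp
  qed
  have "eval_at_q (KL_family n x) = KL_chain n 2 x" for x
  proof (cases "x permutes {1..n}")
    case True
    have e: "2 * int (n - 1 - 2) = 2 * int (n - 3)" "2 - 1 = (1::nat)" by auto
    have r: "1 \<le> x 1" "x 1 \<le> n" "1 \<le> x n" "x n \<le> n" "x 1 \<noteq> x n"
      using ends_range[OF True] n by auto
    have "2 \<le> x n \<longleftrightarrow> x n \<noteq> 1" "x 1 \<le> 1 \<longleftrightarrow> x 1 = 1" using r by auto
    then have "KL_chain n 2 x = (if x 1 \<noteq> n \<and> x n \<noteq> 1 then 1 else 0)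
        + v_pow (2 * int (n - 3)) * (if x n = n \<and> x 1 = 1 then 1 else 0)"
      by (simp only: KL_chain_def T_sum_ends_eq[OF True] e)
    moreover have "eval_at_q 0 = 0" by (simp add: eval_at_q_def)
    ultimately show ?thesis
      using True n by (auto simp: KL_family_def eval_at_q_1 eval_at_q_1_monom)
  next
    case False
    have "eval_at_q 0 = 0" by (simp add: eval_at_q_def)
    with False show ?thesis by (simp add: KL_family_def KL_chain_def T_sum_def ends_def)
  qed
  moreover have "self_dual n (int (coxeter_length n w)) (KL_chain n 2)"
    using self_dual_KL_chain[OF n, of 2] n len tri by simp
  ultimately show "hecke_bar n (hecke_of_polys n w (KL_family n)) = hecke_of_polys n w (KL_family n)"
    unfolding hecke_of_polys_def self_dual_def by simp
qed

section \<open>The two permutations\<close>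

lemma one_line_nth:
  assumes "1 \<le> i" "i \<le> length xs"
  shows "one_line xs i = xs ! (i - 1)"
proof -
  have "map_of (zip [1..<Suc (length xs)] xs) ([1..<Suc (length xs)] ! (i - 1)) = Some (xs ! (i - 1))"
    by (rule map_of_zip_nth) (use assms in auto)
  moreover have "[1..<Suc (length xs)] ! (i - 1) = i" using assms by (simp del: upt_Suc)
  ultimately show ?thesis by (simp add: one_line_def permutation_of_list_def)
qed

lemma one_line_permutes:
  assumes "distinct xs" "set xs = {1..length xs}"
  shows "one_line xs permutes {1..length xs}"
  unfolding one_line_def
proof (rule permutation_of_list_permutes)
  have "length [1..<Suc (length xs)] = length xs" by (simp add: One_nat_def del: upt_Suc)
  moreover have "set [1..<Suc (length xs)] = {1..length xs}" by auto
  ultimately show "list_permutes (zip [1..<Suc (length xs)] xs) {1..length xs}"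
    using assms by (simp add: list_permutes_def del: upt_Suc)
qed

lemma w_perm_apply:
  assumes l: "2 \<le> l" and i: "1 \<le> i" "i \<le> l + 2"
  shows "w_perm l i = (if i = 1 then l + 1 else if i = 2 then l + 2
     else if i = l + 1 then 1 else if i = l + 2 then 2 else l + 3 - i)"
proof -
  let ?r = "decreasing_run l 3"
  let ?xs = "[l + 1, l + 2] @ ?r @ [1, 2]"
  have len: "length ?r = l - 2" by (simp add: decreasing_run_def del: upt_Suc)
  have r: "?r ! j = l - j" if "j < l - 2" for j
    using that by (simp add: decreasing_run_def rev_nth del: upt_Suc)
  have w: "w_perm l i = ?xs ! (i - 1)"
    unfolding w_perm_def by (rule one_line_nth) (use l i len in auto)
  consider "i = 1" | "i = 2" | "3 \<le> i" "i \<le> l" | "i = l + 1" | "i = l + 2" using i by linarith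
  then show ?thesis
  proof cases
    case 3
    then have "?xs ! (i - 1) = ?r ! (i - 3)"
      using len by (auto simp: nth_append nth_Cons' numeral_3_eq_3)
    also have "\<dots> = l - (i - 3)" using 3 l by (intro r) linarith
    finally show ?thesis using 3 w by simp
  qed (use l len w in \<open>auto simp: nth_append nth_Cons'\<close>)
qed

lemma w_perm_permutes:
  assumes "2 \<le> l"
  shows "w_perm l permutes {1..l + 2}"
proof -
  let ?xs = "[l + 1, l + 2] @ decreasing_run l 3 @ [1, 2]"
  have len: "length ?xs = l + 2" using assms by (simp add: decreasing_run_def del: upt_Suc)
  have "set ?xs = {1..l + 2}" using assms by (auto simp: decreasing_run_def simp del: upt_Suc)
  moreover have "distinct ?xs" using assms by (auto simp: decreasing_run_def simp del: upt_Suc)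
  ultimately show ?thesis
    unfolding w_perm_def using one_line_permutes[of ?xs] by (simp only: len)
qed

lemma is_top_w_perm:
  assumes l: "2 \<le> l"
  shows "is_top (l + 2) (w_perm l)"
  unfolding is_top_def
proof (intro conjI ballI impI)
  show "w_perm l permutes {1..l + 2}" by (rule w_perm_permutes[OF l])
  fix a b assume a: "a \<in> {1..l + 2}" and b: "b \<in> {1..l + 2}" and ab: "a < b"
  have wa: "w_perm l a = (if a = 1 then l + 1 else if a = 2 then l + 2
     else if a = l + 1 then 1 else if a = l + 2 then 2 else l + 3 - a)"
    and wb: "w_perm l b = (if b = 1 then l + 1 else if b = 2 then l + 2
     else if b = l + 1 then 1 else if b = l + 2 then 2 else l + 3 - b)"
    using w_perm_apply[OF l] a b by auto
  show "w_perm l a < w_perm l b \<longleftrightarrow> (a = 1 \<and> b = 2) \<or> (Suc a = l + 2 \<and> b = l + 2)"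
  proof -
    consider "a = 1" | "a = 2" | "3 \<le> a" "a \<le> l" | "a = l + 1" | "a = l + 2" using a by fastforce
    then show ?thesis
    proof cases
      case 1
      consider "b = 2" | "3 \<le> b" "b \<le> l" | "b = l + 1" | "b = l + 2" using ab b 1 by fastforce
      then show ?thesis unfolding wa wb using 1 l by cases simp_all
    next
      case 2
      consider "3 \<le> b" "b \<le> l" | "b = l + 1" | "b = l + 2" using ab b 2 by fastforce
      then show ?thesis unfolding wa wb using 2 l by cases simp_all
    next
      case 3
      consider "b \<le> l" | "b = l + 1" | "b = l + 2" using b by fastforce
      then show ?thesis unfolding wa wb using 3 l ab by cases simp_all
    next
      case 4
      then show ?thesis unfolding wa wb using l ab b by auto
    next
      case 5
      then show ?thesis using ab b by auto
    qed
  qed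
qed

lemma x_perm_permutes:
  assumes "1 \<le> l"
  shows "x_perm l permutes {1..l + 2}"
proof -
  let ?xs = "[1] @ decreasing_run (l + 1) 2 @ [l + 2]"
  have len: "length ?xs = l + 2" using assms by (simp add: decreasing_run_def del: upt_Suc)
  have "set ?xs = {1..l + 2}" using assms by (auto simp: decreasing_run_def simp del: upt_Suc)
  moreover have "distinct ?xs" using assms by (auto simp: decreasing_run_def simp del: upt_Suc)
  ultimately show ?thesis
    unfolding x_perm_def using one_line_permutes[of ?xs] by (simp only: len)
qed

lemma x_perm_ends:
  assumes "1 \<le> l"
  shows "x_perm l 1 = 1" "x_perm l (l + 2) = l + 2"
  unfolding x_perm_def
  using one_line_nth[of 1 "[1] @ decreasing_run (l + 1) 2 @ [l + 2]"]
    one_line_nth[of "l + 2" "[1] @ decreasing_run (l + 1) 2 @ [l + 2]"] assms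
  by (auto simp: decreasing_run_def nth_append)

theorem theorem55:
  fixes l :: nat
  assumes "l \<ge> 2"
  shows "KL_poly (l + 2) (x_perm l) (w_perm l) = 1 + monom 1 (l - 1)"
proof -
  have "w_perm l 1 = l + 1" "w_perm l (l + 2) = 2"
    using w_perm_apply[OF assms] assms by auto
  then have "is_KL_family (l + 2) (w_perm l) (KL_family (l + 2))"
    using assms by (intro is_KL_family_KL_family is_top_w_perm) auto
  from KL_poly_eqI[OF this, of "x_perm l"] show ?thesis
    using x_perm_permutes[of l] x_perm_ends[of l] assms by (simp add: KL_family_def)
qed

end
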